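(* In the Delsarte-dual setting of the context, let $\mathbf{k}=(k_1,\dots,k_t),\mathbf{n}=(n_1,\dots,n_t)\in\mathbb{N}^t$ with $k=\sum_ik_i$, $n=\sum_in_i$ and $k_i<n_i$ for $i\in[t]$, and suppose $U$ is decomposable of type $(\mathbf{k},\mathbf{n})$ in $\mathbb{V}(k,q^m)$. Then the Delsarte dual $U^d$ is a decomposable subspace of $\mathbb{V}(n-k,q^m)$ of type $(\mathbf{n}-\mathbf{k},\mathbf{n})$, where $\mathbf{n}-\mathbf{k}=(n_1-k_1,\dots,n_t-k_t)$.
   Context: Let $q$ be a prime power, $m$ a positive integer, $1\le k<n$. Let $\mathbb{V}(n,q^m)$ be an $n$-dim $\mathbb{F}_{q^m}$-space, $W$ an $n$-dim $\mathbb{F}_q$-subspace with $\langle W\rangle_{\mathbb{F}_{q^m}}=\mathbb{V}(n,q^m)$, $\sigma'$ a non-degenerate reflexive $\mathbb{F}_q$-bilinear form on $W$, $\sigma$ its $\mathbb{F}_{q^m}$-bilinear extension, $\perp$ orthogonal complement w.r.t. $\sigma$, $\Gamma$ an $(n-k)$-dim $\mathbb{F}_{q^m}$-subspace with $\Gamma\cap W=\{0\}$; $\mathbb{V}(k,q^m)=\mathbb{V}(n,q^m)/\Gamma$, $U=(W+\Gamma)/\Gamma$, $\mathbb{V}(n-k,q^m)=\mathbb{V}(n,q^m)/\Gamma^\perp$, $U^d=(W+\Gamma^\perp)/\Gamma^\perp$ (a Delsarte dual of $U$). An $\mathbb{F}_q$-subspace $U$ of $\mathbb{F}_q$-dimension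 $n$ of a $k$-dimensional $\mathbb{F}_{q^m}$-space $V$ is decomposable of type $(\mathbf{k},\mathbf{n})$ if $U=U_1\oplus\dots\oplus U_t$ with $\dim_{\mathbb{F}_q}U_i=n_i$ and $V=F_1\oplus\dots\oplus F_t$ where $F_i=\langle U_i\rangle_{\mathbb{F}_{q^m}}$ has dimension $k_i$ (the order of the components is immaterial).
   Formalization: Added hypothesis: U meets every hyperplane of V(k,q^m) in F_q-dimension less than n-1 (equivalently W∩Γ^⊥=0, i.e. dim U^d=n); without it the claim fails, e.g. W=F_q^3 with the dot product, Γ=<(-a,1,0)>, a not in F_q, where dim U^d=2. *)

theory Defs
  imports
    "Jordan_Normal_Form.Missing_VectorSpace"
    "HOL-Algebra.AbelCoset"
    "HOL-Algebra.Subrings"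
    "HOL-Number_Theory.Prime_Powers"
begin

abbreviation lspan :: "('a, 'b) ring_scheme \<Rightarrow> ('a, 'v, 'c) module_scheme \<Rightarrow> 'v set \<Rightarrow> 'v set" where
  "lspan K V S \<equiv> LinearCombinations.module.span K V S"

abbreviation subdim :: "('a, 'b) ring_scheme \<Rightarrow> ('a, 'v, 'c) module_scheme \<Rightarrow> 'v set \<Rightarrow> nat" where
  "subdim K V X \<equiv> vectorspace.dim K (V\<lparr>carrier := X\<rparr>)"

text \<open>
  The \<open>mult\<close> and \<open>one\<close> fields of a module record carry no meaning. In \<open>smult\<close>, adding \<open>N\<close> matters
  only for the zero scalar, whose pointwise multiple of a coset is \<open>{0}\<close> rather than \<open>N\<close>.
\<close>
definition quot_space :: "('a, 'v, 'c) module_scheme \<Rightarrow> 'v set \<Rightarrow> ('a, 'v set) module" where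
  "quot_space V N =
    \<lparr>carrier = a_rcosets\<^bsub>V\<^esub> N, monoid.mult = (\<lambda>_ _. N), one = N, zero = N, add = set_add V,
     smult = (\<lambda>a X. N <+>\<^bsub>V\<^esub> ((\<lambda>x. a \<odot>\<^bsub>V\<^esub> x) ` X))\<rparr>"

definition quot_image :: "('a, 'v, 'c) module_scheme \<Rightarrow> 'v set \<Rightarrow> 'v set \<Rightarrow> 'v set set" where
  "quot_image V N W = (\<lambda>x. N +>\<^bsub>V\<^esub> x) ` (W <+>\<^bsub>V\<^esub> N)"

definition bilinear_form ::
  "('a, 'b) ring_scheme \<Rightarrow> ('a, 'v, 'c) module_scheme \<Rightarrow> ('v \<Rightarrow> 'v \<Rightarrow> 'a) \<Rightarrow> bool" where
  "bilinear_form K V s \<longleftrightarrow>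
     (\<forall>x\<in>carrier V. \<forall>y\<in>carrier V. s x y \<in> carrier K) \<and>
     (\<forall>x\<in>carrier V. \<forall>y\<in>carrier V. \<forall>z\<in>carrier V.
        s (x \<oplus>\<^bsub>V\<^esub> y) z = s x z \<oplus>\<^bsub>K\<^esub> s y z \<and> s z (x \<oplus>\<^bsub>V\<^esub> y) = s z x \<oplus>\<^bsub>K\<^esub> s z y) \<and>
     (\<forall>a\<in>carrier K. \<forall>x\<in>carrier V. \<forall>y\<in>carrier V.
        s (a \<odot>\<^bsub>V\<^esub> x) y = a \<otimes>\<^bsub>K\<^esub> s x y \<and> s x (a \<odot>\<^bsub>V\<^esub> y) = a \<otimes>\<^bsub>K\<^esub> s x y)"

definition reflexive_form ::
  "('a, 'b) ring_scheme \<Rightarrow> ('a, 'v, 'c) module_scheme \<Rightarrow> ('v \<Rightarrow> 'v \<Rightarrow> 'a) \<Rightarrow> bool" where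
  "reflexive_form K V s \<longleftrightarrow>
     (\<forall>x\<in>carrier V. \<forall>y\<in>carrier V. s x y = \<zero>\<^bsub>K\<^esub> \<longrightarrow> s y x = \<zero>\<^bsub>K\<^esub>)"

definition nondegenerate_form ::
  "('a, 'b) ring_scheme \<Rightarrow> ('a, 'v, 'c) module_scheme \<Rightarrow> ('v \<Rightarrow> 'v \<Rightarrow> 'a) \<Rightarrow> bool" where
  "nondegenerate_form K V s \<longleftrightarrow>
     (\<forall>x\<in>carrier V. (\<forall>y\<in>carrier V. s x y = \<zero>\<^bsub>K\<^esub>) \<longrightarrow> x = \<zero>\<^bsub>V\<^esub>) \<and>
     (\<forall>y\<in>carrier V. (\<forall>x\<in>carrier V. s x y = \<zero>\<^bsub>K\<^esub>) \<longrightarrow> y = \<zero>\<^bsub>V\<^esub>)"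

definition orth_compl ::
  "('a, 'b) ring_scheme \<Rightarrow> ('a, 'v, 'c) module_scheme \<Rightarrow> ('v \<Rightarrow> 'v \<Rightarrow> 'a) \<Rightarrow> 'v set \<Rightarrow> 'v set" where
  "orth_compl K V s X = {v \<in> carrier V. \<forall>x\<in>X. s x v = \<zero>\<^bsub>K\<^esub>}"

text \<open>
  Bijectivity says that every element of \<open>S\<close> is a sum of elements of the \<open>X i\<close> in exactly one way.
\<close>
definition internal_direct_sum ::
  "('a, 'v, 'c) module_scheme \<Rightarrow> 'v set \<Rightarrow> 'i set \<Rightarrow> ('i \<Rightarrow> 'v set) \<Rightarrow> bool" where
  "internal_direct_sum V S I X \<longleftrightarrow>
     bij_betw (\<lambda>f. \<Oplus>\<^bsub>V\<^esub>i\<in>I. f i) (\<Pi>\<^sub>E i\<in>I. X i) S"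

text \<open>
  \<open>U\<close> is a subspace over the subfield \<open>F\<close> of \<open>K\<close>, and the type is \<open>((ks 1, \<dots>, ks t), (ns 1, \<dots>, ns t))\<close>.
  The components \<open>Us\<close> are existentially quantified, so a simultaneous permutation of \<open>ks\<close> and \<open>ns\<close>
  does not affect the notion.
\<close>
definition decomposable ::
  "('a, 'b) ring_scheme \<Rightarrow> 'a set \<Rightarrow> ('a, 'v, 'c) module_scheme \<Rightarrow> 'v set \<Rightarrow>
   nat \<Rightarrow> (nat \<Rightarrow> nat) \<Rightarrow> (nat \<Rightarrow> nat) \<Rightarrow> bool" where
  "decomposable K F V U t ks ns \<longleftrightarrow>
     vectorspace K V \<and> vectorspace.fin_dim K V \<and> vectorspace.dim K V = (\<Sum>i=1..t. ks i) \<and>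
     VectorSpace.subspace (K\<lparr>carrier := F\<rparr>) U V \<and>
     vectorspace.fin_dim (K\<lparr>carrier := F\<rparr>) (V\<lparr>carrier := U\<rparr>) \<and>
     subdim (K\<lparr>carrier := F\<rparr>) V U = (\<Sum>i=1..t. ns i) \<and>
     (\<exists>Us. (\<forall>i\<in>{1..t}. VectorSpace.subspace (K\<lparr>carrier := F\<rparr>) (Us i) V \<and>
              subdim (K\<lparr>carrier := F\<rparr>) V (Us i) = ns i \<and>
              subdim K V (lspan K V (Us i)) = ks i) \<and>
           internal_direct_sum V U {1..t} Us \<and>
           internal_direct_sum V (carrier V) {1..t} (\<lambda>i. lspan K V (Us i)))"

text \<open>
  \<open>U\<close> is an \<open>F\<close>-subspace of dimension \<open>n\<close> that meets every \<open>K\<close>-hyperplane of \<open>V\<close> in \<open>F\<close>-dimension less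
  than \<open>n - 1\<close>. This is the condition under which the Delsarte dual of \<open>U\<close> is defined: it holds iff
  the dual again has \<open>F\<close>-dimension \<open>n\<close>. It does not follow from decomposability of \<open>U\<close>, e.g. for
  \<open>U = \<langle>(1,0), (a,0), (0,1)\<rangle>\<close> over \<open>F\<close> in \<open>K\<^sup>2\<close> with \<open>a \<notin> F\<close>.
\<close>
definition has_delsarte_dual ::
  "('a, 'b) ring_scheme \<Rightarrow> 'a set \<Rightarrow> ('a, 'v, 'c) module_scheme \<Rightarrow> 'v set \<Rightarrow> bool" where
  "has_delsarte_dual K F V U \<longleftrightarrow>
     (\<forall>M. VectorSpace.subspace K M V \<and> subdim K V M + 1 = vectorspace.dim K V \<longrightarrow>
          subdim (K\<lparr>carrier := F\<rparr>) V (U \<inter> M) + 1 < subdim (K\<lparr>carrier := F\<rparr>) V U)"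

end

theory Submission
  imports Defs
begin

text \<open>
  Over a finite field the dimension of a space can be read off its cardinality, so all dimension
  formulas are obtained by counting.

  Pulling the components \<open>U\<^sub>i\<close> back to \<open>W\<close> gives \<open>W = \<Oplus> W\<^sub>i\<close>, and then \<open>\<Gamma> = \<Oplus> \<Gamma>\<^sub>i\<close> with
  \<open>\<Gamma>\<^sub>i = \<Gamma> \<inter> \<langle>W\<^sub>i\<rangle>\<close> of dimension at most \<open>n\<^sub>i - k\<^sub>i\<close>. The dual components
  \<open>D\<^sub>i = {w \<in> W. w \<bottom> W\<^sub>j for all j \<noteq> i}\<close> satisfy \<open>W = \<Oplus> D\<^sub>i\<close> and \<open>dim D\<^sub>i = n\<^sub>i\<close>. An element of \<open>\<langle>D\<^sub>i\<rangle>\<close>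
  is determined modulo \<open>\<Gamma>\<^sup>\<bottom>\<close> by its pairing with \<open>\<Gamma>\<^sub>i\<close>, so the image of \<open>\<langle>D\<^sub>i\<rangle>\<close> in \<open>V/\<Gamma>\<^sup>\<bottom>\<close> has dimension
  at most \<open>n\<^sub>i - k\<^sub>i\<close>. These images span \<open>V/\<Gamma>\<^sup>\<bottom>\<close>, whose dimension is at least
  \<open>dim \<Gamma> = n - k = \<Sum> (n\<^sub>i - k\<^sub>i)\<close> because \<open>\<sigma>\<close> is non-degenerate; hence equality holds everywhere and the
  sum is direct. The images of the \<open>D\<^sub>i\<close> keep their \<open>F\<close>-dimension since \<open>W \<inter> \<Gamma>\<^sup>\<bottom> = 0\<close>.
\<close>

section \<open>Finite vector spaces\<close>

lemma card_eq_sum_card_fibres: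
  assumes "finite A"
  shows "card A = (\<Sum>c\<in>f ` A. card {x \<in> A. f x = c})"
  using sum.image_gen[OF assms, of "\<lambda>_. 1::nat" f] by simp

text \<open>Translation by \<open>y\<close> maps the fibre of \<open>f\<close> through
  \<open>y\<close> bijectively onto \<open>A \<inter> N\<close>, so all fibres have the same size.
  Asking only that the fibres be cosets, with no group on the target, lets the lemma serve coset
  maps and scalar-valued functionals alike.\<close>

lemma (in abelian_group) card_eq_card_kernel_times_card_image:
  assumes fin: "finite A" and A: "A \<subseteq> carrier G"
    and add: "\<And>x y. x \<in> A \<Longrightarrow> y \<in> A \<Longrightarrow> x \<oplus> y \<in> A"
    and minus: "\<And>x y. x \<in> A \<Longrightarrow> y \<in> A \<Longrightarrow> x \<ominus> y \<in> A"
    and fibre: "\<And>x y. x \<in> A \<Longrightarrow> y \<in> A \<Longrightarrow> f x = f y \<longleftrightarrow> x \<ominus> y \<in> N"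
  shows "card A = card (A \<inter> N) * card (f ` A)"
proof -
  have "card {x \<in> A. f x = f y} = card (A \<inter> N)" if y: "y \<in> A" for y
  proof -
    have yc: "y \<in> carrier G" using y A by auto
    have "bij_betw (\<lambda>z. z \<ominus> y) {x \<in> A. f x = f y} (A \<inter> N)"
    proof (rule bij_betw_byWitness[where f' = "\<lambda>z. z \<oplus> y"])
      have inv1: "x \<ominus> y \<oplus> y = x" and inv2: "x \<oplus> y \<ominus> y = x" if "x \<in> A" for x
        using that A yc by (auto simp: a_minus_def a_assoc l_neg r_neg)
      show "\<forall>x\<in>{x \<in> A. f x = f y}. x \<ominus> y \<oplus> y = x" using inv1 by auto
      show "\<forall>x\<in>A \<inter> N. x \<oplus> y \<ominus> y = x" using inv2 by auto
      show "(\<lambda>z. z \<ominus> y) ` {x \<in> A. f x = f y} \<subseteq> A \<inter> N"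
        using fibre minus y by auto
      show "(\<lambda>z. z \<oplus> y) ` (A \<inter> N) \<subseteq> {x \<in> A. f x = f y}"
        using fibre add y inv2 by auto
    qed
    then show ?thesis by (rule bij_betw_same_card)
  qed
  then have "(\<Sum>c\<in>f ` A. card {x \<in> A. f x = c}) = (\<Sum>c\<in>f ` A. card (A \<inter> N))"
    by (intro sum.cong) auto
  then show ?thesis
    using card_eq_sum_card_fibres[OF fin, of f] by simp
qed

text \<open>\<open>g\<close> factors through the value vector \<open>h x\<close>, which ranges over
  at most \<open>card R ^ card J\<close> possibilities. All upper bounds on dimensions that come
  from pairing with a finite basis are obtained this way.\<close>

lemma card_image_le_pow:
  assumes "finite J" "finite R" "finite A"
    and val: "\<And>x j. x \<in> A \<Longrightarrow> j \<in> J \<Longrightarrow> f x j \<in> R"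
    and det: "\<And>x y. x \<in> A \<Longrightarrow> y \<in> A \<Longrightarrow> (\<And>j. j \<in> J \<Longrightarrow> f x j = f y j) \<Longrightarrow> g x = g y"
  shows "card (g ` A) \<le> card R ^ card J"
proof -
  define h where "h x = restrict (f x) J" for x
  have sub: "h ` A \<subseteq> J \<rightarrow>\<^sub>E R" using val by (auto simp: h_def)
  have eq: "g (inv_into A h (h x)) = g x" if x: "x \<in> A" for x
  proof (rule det)
    have hx: "h x \<in> h ` A" using x by simp
    show "inv_into A h (h x) \<in> A" using inv_into_into[OF hx] .
    show "f (inv_into A h (h x)) j = f x j" if "j \<in> J" for j
      using f_inv_into_f[OF hx] that unfolding h_def by (metis restrict_apply')
  qed (rule x)
  have "g ` A = (\<lambda>u. g (inv_into A h u)) ` h ` A"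
    unfolding image_image using eq by (intro image_cong) auto
  then have "card (g ` A) \<le> card (h ` A)"
    by (metis card_image_le finite_imageI assms(3))
  also have "\<dots> \<le> card (J \<rightarrow>\<^sub>E R)"
    using sub assms by (intro card_mono finite_PiE) auto
  also have "\<dots> = card R ^ card J" using assms by (simp add: card_PiE)
  finally show ?thesis .
qed

section \<open>Subspaces and spans\<close>

lemma (in vectorspace) subspace_iff:
  "VectorSpace.subspace K X V \<longleftrightarrow>
     X \<subseteq> carrier V \<and> \<zero>\<^bsub>V\<^esub> \<in> X \<and> (\<forall>x\<in>X. \<forall>y\<in>X. x \<oplus>\<^bsub>V\<^esub> y \<in> X) \<and>
     (\<forall>a\<in>carrier K. \<forall>x\<in>X. a \<odot>\<^bsub>V\<^esub> x \<in> X)"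
  unfolding VectorSpace.subspace_def LinearCombinations.submodule_def
  using vectorspace_axioms module_axioms by auto

lemma (in vectorspace) subspace_minus:
  assumes "VectorSpace.subspace K X V" "x \<in> X" "y \<in> X"
  shows "x \<ominus>\<^bsub>V\<^esub> y \<in> X"
proof -
  have "y \<in> carrier V" using assms by (auto simp: subspace_iff)
  then have "\<ominus>\<^bsub>V\<^esub> y = (\<ominus>\<^bsub>K\<^esub> \<one>\<^bsub>K\<^esub>) \<odot>\<^bsub>V\<^esub> y" by (simp add: smult_l_minus)
  then show ?thesis using assms by (auto simp: a_minus_def subspace_iff)
qed

lemma (in vectorspace) subspace_finsum:
  assumes "VectorSpace.subspace K X V" "\<And>i. i \<in> I \<Longrightarrow> f i \<in> X"
  shows "finsum V f I \<in> X"
  using assms(2)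
proof (induction I rule: infinite_finite_induct)
  case (insert i I)
  have "f \<in> I \<rightarrow> carrier V" "f i \<in> carrier V"
    using insert assms(1) by (auto simp: subspace_iff)
  then show ?case using insert assms(1) by (auto simp: subspace_iff)
qed (use assms(1) in \<open>auto simp: subspace_iff\<close>)

lemma (in vectorspace) span_superset: "S \<subseteq> carrier V \<Longrightarrow> S \<subseteq> span S"
  by (rule in_own_span)

lemma (in vectorspace) span_minimal:
  assumes "VectorSpace.subspace K X V" "S \<subseteq> X"
  shows "span S \<subseteq> X"
  using assms by (intro span_is_subset) auto

lemma (in vectorspace) span_eq_self:
  assumes "VectorSpace.subspace K X V"
  shows "span X = X"
  using span_minimal[OF assms] in_own_span[of X] assms by (auto simp: subspace_iff)

lemma (in vectorspace) fin_dim_imp_finite_carrier: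
  assumes "fin_dim" and "finite (carrier K)"
  shows "finite (carrier V)"
proof -
  obtain B where B: "finite B" "B \<subseteq> carrier V" "span B = carrier V"
    using assms(1) unfolding fin_dim_def by blast
  have "carrier V \<subseteq> (\<lambda>a. lincomb a B) ` (B \<rightarrow>\<^sub>E carrier K)"
  proof
    fix v assume "v \<in> carrier V"
    then obtain a where a: "a \<in> B \<rightarrow> carrier K" "lincomb a B = v"
      using finite_in_span[OF B(1,2)] B(3) by blast
    \<comment> \<open>Cutting the coefficients down to \<open>B\<close> puts them in the extensional
      function space, which is finite.\<close>
    have "lincomb (restrict a B) B = lincomb a B"
      using a(1) B(2) unfolding lincomb_def by (intro M.finsum_cong') auto
    moreover have "restrict a B \<in> B \<rightarrow>\<^sub>E carrier K" using a(1) by auto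
    ultimately show "v \<in> (\<lambda>a. lincomb a B) ` (B \<rightarrow>\<^sub>E carrier K)"
      using a(2) by (intro image_eqI[of _ _ "restrict a B"]) auto
  qed
  then show ?thesis
    by (rule finite_subset) (use B(1) assms(2) in \<open>simp add: finite_PiE\<close>)
qed

text \<open>Finiteness of the carrier, rather than \<open>fin_dim\<close>, is the invariant: it
  passes at once to subspaces, quotients and smaller scalar fields, and \<open>fin_dim\<close>
  follows from it.\<close>

locale finite_vectorspace = vectorspace +
  assumes finite_scalars: "finite (carrier K)" and finite_carrier: "finite (carrier V)"
begin

lemma fin_dim: "fin_dim"
  unfolding fin_dim_def
  using finite_carrier span_eq_self[of "carrier V"] by (auto simp: subspace_iff)

text \<open>Coordinates with respect to a basis are unique once coefficient functions are taken
  extensional on \<open>B\<close>.\<close>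

lemma card_carrier: "card (carrier V) = card (carrier K) ^ dim"
proof -
  obtain B where B: "finite B" "basis B" using finite_basis_exists[OF fin_dim] by blast
  have BV: "B \<subseteq> carrier V" using B by (auto simp: basis_def)
  have "bij_betw (\<lambda>a. lincomb a B) (B \<rightarrow>\<^sub>E carrier K) (carrier V)"
  proof (rule bij_betwI')
    have uniq: "\<exists>!a. a \<in> B \<rightarrow>\<^sub>E carrier K \<and> lincomb a B = v" if "v \<in> carrier V" for v
      using B(2) that unfolding basis_criterion[OF B(1) BV] by blast
    show cl: "lincomb a B \<in> carrier V" if "a \<in> B \<rightarrow>\<^sub>E carrier K" for a
      using that BV by (intro lincomb_closed) auto
    show "(lincomb a B = lincomb b B) = (a = b)"
      if "a \<in> B \<rightarrow>\<^sub>E carrier K" "b \<in> B \<rightarrow>\<^sub>E carrier K" for a b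
      using uniq[OF cl[OF that(1)]] that by auto
    show "\<exists>a\<in>B \<rightarrow>\<^sub>E carrier K. v = lincomb a B" if "v \<in> carrier V" for v
      using uniq[OF that] by blast
  qed
  then have "card (carrier V) = card (B \<rightarrow>\<^sub>E carrier K)" by (metis bij_betw_same_card)
  also have "\<dots> = card (carrier K) ^ card B" using B by (simp add: card_PiE)
  finally show ?thesis using dim_basis[OF B] by simp
qed

text \<open>With a base above one, equalities and inequalities between powers descend to the
  exponents, that is, from cardinalities to dimensions.\<close>

lemma card_scalars_gt_1: "card (carrier K) > 1"
proof -
  have "card {\<zero>\<^bsub>K\<^esub>, \<one>\<^bsub>K\<^esub>} \<le> card (carrier K)" by (intro card_mono finite_scalars) auto
  then show ?thesis by simp
qed

lemma finite_subspace: "VectorSpace.subspace K X V \<Longrightarrow> finite X"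
  using finite_carrier by (auto simp: subspace_iff intro: finite_subset)

lemma subspace_finite_vectorspace:
  assumes "VectorSpace.subspace K X V"
  shows "finite_vectorspace K (V\<lparr>carrier := X\<rparr>)"
  using subspace_is_vs[OF assms] finite_subspace[OF assms] finite_scalars
  by (simp add: finite_vectorspace_def finite_vectorspace_axioms_def)

lemma card_subspace:
  assumes "VectorSpace.subspace K X V"
  shows "card X = card (carrier K) ^ subdim K V X"
  using finite_vectorspace.card_carrier[OF subspace_finite_vectorspace[OF assms]] by simp

lemma subdim_eq_iff:
  assumes "VectorSpace.subspace K X V"
  shows "subdim K V X = d \<longleftrightarrow> card X = card (carrier K) ^ d"
  using card_subspace[OF assms] card_scalars_gt_1 by simp

lemma subspace_basis:
  assumes "VectorSpace.subspace K X V"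
  obtains B where "finite B" "B \<subseteq> X" "span B = X" "card B = subdim K V X"
proof -
  interpret X: finite_vectorspace K "V\<lparr>carrier := X\<rparr>"
    by (rule subspace_finite_vectorspace[OF assms])
  obtain B where B: "finite B" "X.basis B" using X.finite_basis_exists[OF X.fin_dim] by blast
  have "B \<subseteq> X" using B by (auto simp: X.basis_def)
  \<comment> \<open>The basis is one of \<open>X\<close> as a space in its own right; its span there
    agrees with its span in \<open>V\<close>.\<close>
  moreover have "span B = X"
    using B span_li_not_depend(1)[OF \<open>B \<subseteq> X\<close>] assms by (auto simp: X.basis_def)
  ultimately show thesis using that B X.dim_basis[OF B] by auto
qed

end

section \<open>Restriction of scalars to a subfield\<close>

lemma (in vectorspace) restrict_scalars:
  assumes "subfield F K"
  shows "vectorspace (K\<lparr>carrier := F\<rparr>) V"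
proof -
  have F: "F \<subseteq> carrier K" using subfieldE(3)[OF assms] .
  have f: "field (K\<lparr>carrier := F\<rparr>)" using subfield_iff(2)[OF assms] .
  then interpret E: field "K\<lparr>carrier := F\<rparr>" .
  have "Module.module (K\<lparr>carrier := F\<rparr>) V"
    apply (rule moduleI)
    using F E.is_cring M.abelian_group_axioms
    by (auto simp: smult_l_distr smult_r_distr smult_assoc1 subset_iff)
  then show ?thesis using f by (simp add: vectorspace_def)
qed

lemma (in vectorspace) subspace_restrict_scalars:
  assumes "subfield F K" "VectorSpace.subspace K X V"
  shows "VectorSpace.subspace (K\<lparr>carrier := F\<rparr>) X V"
  using assms(2) subfieldE(3)[OF assms(1)]
  unfolding subspace_iff vectorspace.subspace_iff[OF restrict_scalars[OF assms(1)]] by auto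

section \<open>Linear maps, subspaces and spans\<close>

lemma (in linear_map) image_subspace:
  assumes "VectorSpace.subspace K X V"
  shows "VectorSpace.subspace K (T ` X) W"
proof -
  have X: "X \<subseteq> carrier V" "\<zero>\<^bsub>V\<^esub> \<in> X" "\<And>x y. x \<in> X \<Longrightarrow> y \<in> X \<Longrightarrow> x \<oplus>\<^bsub>V\<^esub> y \<in> X"
    "\<And>a x. a \<in> carrier K \<Longrightarrow> x \<in> X \<Longrightarrow> a \<odot>\<^bsub>V\<^esub> x \<in> X"
    using assms by (auto simp: V.subspace_iff)
  show ?thesis unfolding W.subspace_iff
  proof (intro conjI ballI)
    show "T ` X \<subseteq> carrier W" using X(1) by auto
    show "\<zero>\<^bsub>W\<^esub> \<in> T ` X" using X(2) T0_is_0 by (metis imageI)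
    show "u \<oplus>\<^bsub>W\<^esub> v \<in> T ` X" if uv: "u \<in> T ` X" "v \<in> T ` X" for u v
    proof -
      obtain x y where "x \<in> X" "y \<in> X" "u = T x" "v = T y" using uv by blast
      then show ?thesis using X T_add[of x y] by (metis imageI subsetD)
    qed
    show "a \<odot>\<^bsub>W\<^esub> u \<in> T ` X" if au: "a \<in> carrier K" "u \<in> T ` X" for a u
    proof -
      obtain x where "x \<in> X" "u = T x" using au by blast
      then show ?thesis using X T_smult[of a x] au by (metis imageI subsetD)
    qed
  qed
qed

lemma (in linear_map) vimage_subspace:
  assumes "VectorSpace.subspace K Y W"
  shows "VectorSpace.subspace K {x \<in> carrier V. T x \<in> Y} V"
  using assms unfolding V.subspace_iff W.subspace_iff by auto

lemma (in linear_map) image_span: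
  assumes "S \<subseteq> carrier V"
  shows "T ` lspan K V S = lspan K W (T ` S)"
proof
  have TS: "T ` S \<subseteq> carrier W" using assms by auto
  have "S \<subseteq> {x \<in> carrier V. T x \<in> lspan K W (T ` S)}"
    using assms W.span_superset[OF TS] by auto
  then have "lspan K V S \<subseteq> {x \<in> carrier V. T x \<in> lspan K W (T ` S)}"
    using vimage_subspace W.span_is_subspace[OF TS] V.span_minimal by blast
  then show "T ` lspan K V S \<subseteq> lspan K W (T ` S)" by auto
  show "lspan K W (T ` S) \<subseteq> T ` lspan K V S"
    using V.span_superset[OF assms] image_subspace[OF V.span_is_subspace[OF assms]]
    by (intro W.span_minimal) auto
qed

section \<open>Quotients and sums of subspaces\<close>

text \<open>A surjection that respects the operations carries the axioms over, so the quotient space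
  needs no separate check of each axiom on cosets.\<close>

lemma vectorspace_surj_image:
  assumes "vectorspace K V"
    and carr: "carrier P = h ` carrier V" and zero: "\<zero>\<^bsub>P\<^esub> = h \<zero>\<^bsub>V\<^esub>"
    and add: "\<And>x y. x \<in> carrier V \<Longrightarrow> y \<in> carrier V \<Longrightarrow> h x \<oplus>\<^bsub>P\<^esub> h y = h (x \<oplus>\<^bsub>V\<^esub> y)"
    and smult: "\<And>a x. a \<in> carrier K \<Longrightarrow> x \<in> carrier V \<Longrightarrow> a \<odot>\<^bsub>P\<^esub> h x = h (a \<odot>\<^bsub>V\<^esub> x)"
  shows "vectorspace K P"
proof -
  interpret vectorspace K V by fact
  have neg: "\<exists>y\<in>carrier V. h (x \<oplus>\<^bsub>V\<^esub> y) = h \<zero>\<^bsub>V\<^esub>" if "x \<in> carrier V" for x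
    using that M.r_neg by (metis M.a_inv_closed)
  show ?thesis
    by (rule vs_criteria)
      (use field_axioms neg in \<open>auto simp: carr zero add smult M.a_assoc smult_assoc1
        smult_l_distr smult_r_distr intro: arg_cong[OF M.a_comm]\<close>)
qed

section \<open>Cosets and the quotient space\<close>

context vectorspace
begin

lemma subspace_abelian_subgroup:
  assumes "VectorSpace.subspace K N V"
  shows "abelian_subgroup N V"
proof (rule abelian_subgroupI3)
  have "\<ominus>\<^bsub>V\<^esub> x \<in> N" if "x \<in> N" for x
    using subspace_minus[OF assms _ that, of "\<zero>\<^bsub>V\<^esub>"] assms that
    by (auto simp: subspace_iff a_minus_def subset_iff)
  then show "additive_subgroup N V"
    using assms
    by (intro additive_subgroupI subgroup.intro) (auto simp: subspace_iff a_inv_def[symmetric])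
qed (rule M.abelian_group_axioms)

text \<open>The axioms are transported along the coset map. The coset computation that remains is
  the one for scalars, \<open>N + a(N + x) = N + ax\<close>, which rests on \<open>aN\<close> lying
  in \<open>N\<close>.\<close>

lemma quot_space_vectorspace_and_proj:
  assumes N: "VectorSpace.subspace K N V"
  shows quot_space_vectorspace: "vectorspace K (quot_space V N)"
    and quot_space_proj_linear: "linear_map K V (quot_space V N) (\<lambda>x. N +>\<^bsub>V\<^esub> x)"
proof -
  interpret N: abelian_subgroup N V by (rule subspace_abelian_subgroup[OF N])
  have smult: "N <+>\<^bsub>V\<^esub> ((\<odot>\<^bsub>V\<^esub>) a ` (N +>\<^bsub>V\<^esub> x)) = N +>\<^bsub>V\<^esub> (a \<odot>\<^bsub>V\<^esub> x)"
    if a: "a \<in> carrier K" and x: "x \<in> carrier V" for a x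
  proof -
    have closed: "u \<oplus>\<^bsub>V\<^esub> a \<odot>\<^bsub>V\<^esub> v \<in> N" if "u \<in> N" "v \<in> N" for u v
      using that a N by (auto simp: subspace_iff)
    have eq: "u \<oplus>\<^bsub>V\<^esub> a \<odot>\<^bsub>V\<^esub> (v \<oplus>\<^bsub>V\<^esub> x) = (u \<oplus>\<^bsub>V\<^esub> a \<odot>\<^bsub>V\<^esub> v) \<oplus>\<^bsub>V\<^esub> a \<odot>\<^bsub>V\<^esub> x"
      if "u \<in> N" "v \<in> N" for u v
      using that a x by (simp add: smult_r_distr M.a_assoc)
    show ?thesis
      unfolding set_add_def' a_r_coset_def'
    proof (intro equalityI subsetI)
      fix z assume "z \<in> (\<Union>u\<in>N. \<Union>w\<in>(\<odot>\<^bsub>V\<^esub>) a ` (\<Union>v\<in>N. {v \<oplus>\<^bsub>V\<^esub> x}). {u \<oplus>\<^bsub>V\<^esub> w})"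
      then obtain u v where uv: "u \<in> N" "v \<in> N" "z = u \<oplus>\<^bsub>V\<^esub> a \<odot>\<^bsub>V\<^esub> (v \<oplus>\<^bsub>V\<^esub> x)" by auto
      show "z \<in> (\<Union>u\<in>N. {u \<oplus>\<^bsub>V\<^esub> a \<odot>\<^bsub>V\<^esub> x})"
        using closed[OF uv(1,2)] eq[OF uv(1,2)] uv(3) by (simp only:) blast
    next
      fix z assume "z \<in> (\<Union>u\<in>N. {u \<oplus>\<^bsub>V\<^esub> a \<odot>\<^bsub>V\<^esub> x})"
      \<comment> \<open>Writing \<open>x\<close> as zero plus \<open>x\<close> exhibits it as an
        element of its own coset.\<close>
      then obtain u where u: "u \<in> N" "z = u \<oplus>\<^bsub>V\<^esub> a \<odot>\<^bsub>V\<^esub> (\<zero>\<^bsub>V\<^esub> \<oplus>\<^bsub>V\<^esub> x)" using x by auto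
      have "\<zero>\<^bsub>V\<^esub> \<oplus>\<^bsub>V\<^esub> x \<in> (\<Union>v\<in>N. {v \<oplus>\<^bsub>V\<^esub> x})" using N.zero_closed by blast
      then show "z \<in> (\<Union>u\<in>N. \<Union>w\<in>(\<odot>\<^bsub>V\<^esub>) a ` (\<Union>v\<in>N. {v \<oplus>\<^bsub>V\<^esub> x}). {u \<oplus>\<^bsub>V\<^esub> w})"
        using u by blast
    qed
  qed
  have zero: "N +>\<^bsub>V\<^esub> \<zero>\<^bsub>V\<^esub> = N" by (simp add: N.a_subset)
  show "vectorspace K (quot_space V N)"
    by (rule vectorspace_surj_image[OF vectorspace_axioms, where h = "\<lambda>x. N +>\<^bsub>V\<^esub> x"])
      (auto simp: quot_space_def A_RCOSETS_def' N.a_rcos_sum smult zero)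
  then show "linear_map K V (quot_space V N) (\<lambda>x. N +>\<^bsub>V\<^esub> x)"
    using vectorspace_axioms
    by (auto simp: linear_map_def mod_hom_def mod_hom_axioms_def LinearCombinations.module_hom_def vectorspace_def
        quot_space_def A_RCOSETS_def' N.a_rcos_sum smult)
qed

lemma quot_space_carrier: "carrier (quot_space V N) = (\<lambda>x. N +>\<^bsub>V\<^esub> x) ` carrier V"
  by (auto simp: quot_space_def A_RCOSETS_def')

lemma coset_eq_iff:
  assumes N: "VectorSpace.subspace K N V" and x: "x \<in> carrier V" and y: "y \<in> carrier V"
  shows "N +>\<^bsub>V\<^esub> x = N +>\<^bsub>V\<^esub> y \<longleftrightarrow> x \<ominus>\<^bsub>V\<^esub> y \<in> N"
proof -
  interpret N: abelian_subgroup N V by (rule subspace_abelian_subgroup[OF N])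
  have "N +>\<^bsub>V\<^esub> x = N +>\<^bsub>V\<^esub> y \<longleftrightarrow> x \<in> N +>\<^bsub>V\<^esub> y"
    using N.a_repr_independence'[OF _ y] N.a_repr_independenceD[OF x] N.a_rcos_self[OF x] x y by metis
  then show ?thesis using N.a_rcos_module[OF y x] by (simp add: a_minus_def)
qed

text \<open>Elements of \<open>N\<close> vanish in the quotient, so enlarging \<open>W\<close> by
  \<open>N\<close> creates no new cosets.\<close>

lemma quot_image_eq:
  assumes N: "VectorSpace.subspace K N V" and W: "W \<subseteq> carrier V"
  shows "quot_image V N W = (\<lambda>x. N +>\<^bsub>V\<^esub> x) ` W"
proof -
  have NV: "N \<subseteq> carrier V" "\<zero>\<^bsub>V\<^esub> \<in> N" using N by (auto simp: subspace_iff)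
  have eq: "N +>\<^bsub>V\<^esub> (w \<oplus>\<^bsub>V\<^esub> u) = N +>\<^bsub>V\<^esub> w" if "w \<in> W" "u \<in> N" for w u
  proof -
    have "w \<in> carrier V" "u \<in> carrier V" using that NV W by auto
    then show ?thesis
      using that(2) coset_eq_iff[OF N, of "w \<oplus>\<^bsub>V\<^esub> u" w]
      by (simp add: a_minus_def M.a_comm[of w u] M.a_assoc M.r_neg)
  qed
  show ?thesis
  proof
    show "quot_image V N W \<subseteq> (\<lambda>x. N +>\<^bsub>V\<^esub> x) ` W"
      unfolding quot_image_def set_add_def' using eq by auto
    have "w \<in> W <+>\<^bsub>V\<^esub> N" if "w \<in> W" for w
    proof -
      have "w = w \<oplus>\<^bsub>V\<^esub> \<zero>\<^bsub>V\<^esub>" using that W by (simp add: subset_iff)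
      then show ?thesis unfolding set_add_def' using that NV(2) by blast
    qed
    then show "(\<lambda>x. N +>\<^bsub>V\<^esub> x) ` W \<subseteq> quot_image V N W" unfolding quot_image_def by auto
  qed
qed

end

text \<open>The range of the map whose bijectivity defines \<open>internal_direct_sum\<close>. This
  separates generation, which linear maps preserve, from directness, which is recovered by
  counting.\<close>

definition sumset :: "('a, 'v, 'c) module_scheme \<Rightarrow> 'i set \<Rightarrow> ('i \<Rightarrow> 'v set) \<Rightarrow> 'v set" where
  "sumset V I X = (\<lambda>f. \<Oplus>\<^bsub>V\<^esub>i\<in>I. f i) ` (\<Pi>\<^sub>E i\<in>I. X i)"

lemma internal_direct_sum_sumset: "internal_direct_sum V S I X \<Longrightarrow> sumset V I X = S"
  by (simp add: internal_direct_sum_def sumset_def bij_betw_def)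

lemma card_sumset_le:
  assumes "finite I" "\<And>i. i \<in> I \<Longrightarrow> finite (X i)"
  shows "card (sumset V I X) \<le> (\<Prod>i\<in>I. card (X i))"
  unfolding sumset_def card_PiE[OF assms(1), symmetric]
  by (intro card_image_le finite_PiE assms)

text \<open>A surjection between finite sets of equal size is injective.\<close>

lemma internal_direct_sumI_card:
  assumes "finite I" "\<And>i. i \<in> I \<Longrightarrow> finite (X i)"
    and "sumset V I X = S" "card S = (\<Prod>i\<in>I. card (X i))"
  shows "internal_direct_sum V S I X"
  unfolding internal_direct_sum_def bij_betw_def
proof
  show im: "(\<lambda>f. \<Oplus>\<^bsub>V\<^esub>i\<in>I. f i) ` (\<Pi>\<^sub>E i\<in>I. X i) = S" using assms(3) by (simp add: sumset_def)
  show "inj_on (\<lambda>f. \<Oplus>\<^bsub>V\<^esub>i\<in>I. f i) (\<Pi>\<^sub>E i\<in>I. X i)"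
    by (rule eq_card_imp_inj_on) (use assms in \<open>simp_all add: finite_PiE im card_PiE\<close>)
qed

lemma (in vectorspace) sumset_mem:
  assumes "\<And>i. i \<in> I \<Longrightarrow> f i \<in> X i" "\<And>i. i \<in> I \<Longrightarrow> X i \<subseteq> carrier V"
  shows "(\<Oplus>\<^bsub>V\<^esub>i\<in>I. f i) \<in> sumset V I X"
proof -
  \<comment> \<open>Families in the product are undefined off \<open>I\<close>, hence the
    restriction.\<close>
  have "(\<Oplus>\<^bsub>V\<^esub>i\<in>I. f i) = (\<Oplus>\<^bsub>V\<^esub>i\<in>I. restrict f I i)"
    using assms by (intro M.finsum_cong') (auto, blast)
  then show ?thesis unfolding sumset_def using assms(1) by (intro image_eqI) auto
qed

lemma sumsetE:
  assumes "v \<in> sumset V I X"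
  obtains f where "\<And>i. i \<in> I \<Longrightarrow> f i \<in> X i" "v = (\<Oplus>\<^bsub>V\<^esub>i\<in>I. f i)"
proof -
  obtain f where "f \<in> (\<Pi>\<^sub>E i\<in>I. X i)" "v = (\<Oplus>\<^bsub>V\<^esub>i\<in>I. f i)"
    using assms unfolding sumset_def by blast
  then show thesis using that PiE_mem by metis
qed

lemma (in vectorspace) sumset_subspace:
  assumes X: "\<And>i. i \<in> I \<Longrightarrow> VectorSpace.subspace K (X i) V"
  shows "VectorSpace.subspace K (sumset V I X) V"
proof -
  have XV: "X i \<subseteq> carrier V" if "i \<in> I" for i using X[OF that] by (simp add: subspace_iff)
  have mem: "(\<Oplus>\<^bsub>V\<^esub>i\<in>I. f i) \<in> sumset V I X" if "\<And>i. i \<in> I \<Longrightarrow> f i \<in> X i" for f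
    using sumset_mem[of I f X] that XV by blast
  show ?thesis unfolding subspace_iff
  proof (intro conjI ballI)
    show "sumset V I X \<subseteq> carrier V"
      using XV by (auto simp: sumset_def PiE_def Pi_def intro!: M.finsum_closed)
    have "(\<Oplus>\<^bsub>V\<^esub>i\<in>I. \<zero>\<^bsub>V\<^esub>) \<in> sumset V I X" using X by (intro mem) (simp add: subspace_iff)
    then show "\<zero>\<^bsub>V\<^esub> \<in> sumset V I X" by simp
    show "x \<oplus>\<^bsub>V\<^esub> y \<in> sumset V I X" if xy: "x \<in> sumset V I X" "y \<in> sumset V I X" for x y
    proof -
      obtain f g where f: "\<And>i. i \<in> I \<Longrightarrow> f i \<in> X i" "x = (\<Oplus>\<^bsub>V\<^esub>i\<in>I. f i)"
        and g: "\<And>i. i \<in> I \<Longrightarrow> g i \<in> X i" "y = (\<Oplus>\<^bsub>V\<^esub>i\<in>I. g i)"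
        using xy by (metis sumsetE)
      have "x \<oplus>\<^bsub>V\<^esub> y = (\<Oplus>\<^bsub>V\<^esub>i\<in>I. f i \<oplus>\<^bsub>V\<^esub> g i)"
        unfolding f(2) g(2) using f(1) g(1) XV by (subst M.finsum_addf) (auto simp: Pi_def)
      then show ?thesis using f(1) g(1) X by (auto simp: subspace_iff intro: mem)
    qed
    show "a \<odot>\<^bsub>V\<^esub> x \<in> sumset V I X" if ax: "a \<in> carrier K" "x \<in> sumset V I X" for a x
    proof -
      obtain f where f: "\<And>i. i \<in> I \<Longrightarrow> f i \<in> X i" "x = (\<Oplus>\<^bsub>V\<^esub>i\<in>I. f i)"
        using ax by (metis sumsetE)
      have "a \<odot>\<^bsub>V\<^esub> x = (\<Oplus>\<^bsub>V\<^esub>i\<in>I. a \<odot>\<^bsub>V\<^esub> f i)"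
      \<comment> \<open>Over an infinite index set \<open>finsum\<close> is zero by convention, and
        zero is fixed by every scalar.\<close>
      proof (cases "finite I")
        case True
        then show ?thesis unfolding f(2) using f(1) XV ax
          by (subst finsum_smult_ldistr) (auto simp: Pi_def)
      next
        case False
        then show ?thesis using ax by (simp add: f(2))
      qed
      then show ?thesis using f(1) X ax by (auto simp: subspace_iff intro: mem)
    qed
  qed
qed

lemma (in vectorspace) sumset_component:
  assumes "finite I" "i \<in> I" "x \<in> X i" "\<And>j. j \<in> I \<Longrightarrow> X j \<subseteq> carrier V" "\<And>j. j \<in> I \<Longrightarrow> \<zero>\<^bsub>V\<^esub> \<in> X j"
  shows "x \<in> sumset V I X"
proof -
  \<comment> \<open>The family concentrated at \<open>i\<close> sums to its single nontrivial
    entry.\<close>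
  have "(\<Oplus>\<^bsub>V\<^esub>j\<in>I. if i = j then x else \<zero>\<^bsub>V\<^esub>) = x"
    using assms by (intro M.add.finprod_singleton) auto
  moreover have "(\<Oplus>\<^bsub>V\<^esub>j\<in>I. if i = j then x else \<zero>\<^bsub>V\<^esub>) \<in> sumset V I X"
    using assms by (intro sumset_mem) auto
  ultimately show ?thesis by simp
qed

text \<open>The sum of the spans is a subspace containing \<open>W\<close>, and each of them lies in
  the span of \<open>W\<close>. It turns a decomposition of \<open>W\<close> over \<open>F\<close>
  into a generation statement for \<open>V\<close> over \<open>K\<close>; directness is not
  claimed.\<close>

lemma (in vectorspace) sumset_span:
  assumes X: "\<And>i. i \<in> I \<Longrightarrow> X i \<subseteq> carrier V" and "sumset V I X = W" and "W \<subseteq> carrier V"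
    and "\<And>i. i \<in> I \<Longrightarrow> X i \<subseteq> W"
  shows "sumset V I (\<lambda>i. span (X i)) = span W"
proof
  have sp: "VectorSpace.subspace K (span (X i)) V" if "i \<in> I" for i
    using span_is_subspace[OF X[OF that]] .
  have "v \<in> sumset V I (\<lambda>i. span (X i))" if "v \<in> W" for v
  proof -
    obtain f where f: "\<And>i. i \<in> I \<Longrightarrow> f i \<in> X i" "v = (\<Oplus>\<^bsub>V\<^esub>i\<in>I. f i)"
      using \<open>v \<in> W\<close> assms(2) sumsetE by metis
    have "f i \<in> span (X i)" if "i \<in> I" for i using f(1)[OF that] span_superset[OF X[OF that]] by blast
    then show ?thesis unfolding f(2)
      by (intro sumset_mem) (use sp in \<open>auto simp: subspace_iff\<close>)
  qed
  then show "span W \<subseteq> sumset V I (\<lambda>i. span (X i))"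
    by (intro span_minimal sumset_subspace sp) auto
  have sub: "span (X i) \<subseteq> span W" if "i \<in> I" for i using assms(4)[OF that] by (rule span_is_monotone)
  show "sumset V I (\<lambda>i. span (X i)) \<subseteq> span W"
  proof
    fix v assume "v \<in> sumset V I (\<lambda>i. span (X i))"
    then obtain f where f: "\<And>i. i \<in> I \<Longrightarrow> f i \<in> span (X i)" "v = (\<Oplus>\<^bsub>V\<^esub>i\<in>I. f i)"
      by (metis sumsetE)
    show "v \<in> span W" unfolding f(2)
      by (rule subspace_finsum[OF span_is_subspace[OF assms(3)]]) (use f(1) sub in blast)
  qed
qed

lemma (in vectorspace) finsum_carrier:
  "(\<And>i. i \<in> I \<Longrightarrow> g i \<in> carrier V) \<Longrightarrow> (\<Oplus>\<^bsub>V\<^esub>i\<in>I. g i) \<in> carrier V"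
  by (auto intro: M.finsum_closed)

lemma (in vectorspace) finsum_insert':
  "finite I \<Longrightarrow> i \<notin> I \<Longrightarrow> (\<And>j. j \<in> insert i I \<Longrightarrow> g j \<in> carrier V) \<Longrightarrow>
    (\<Oplus>\<^bsub>V\<^esub>j\<in>insert i I. g j) = g i \<oplus>\<^bsub>V\<^esub> (\<Oplus>\<^bsub>V\<^esub>j\<in>I. g j)"
  by (rule M.finsum_insert) auto

lemma (in vectorspace) finsum_cong_carrier:
  "(\<And>i. i \<in> I \<Longrightarrow> f i = g i) \<Longrightarrow> (\<And>i. i \<in> I \<Longrightarrow> g i \<in> carrier V) \<Longrightarrow>
    (\<Oplus>\<^bsub>V\<^esub>i\<in>I. f i) = (\<Oplus>\<^bsub>V\<^esub>i\<in>I. g i)"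
  by (rule M.finsum_cong') auto

lemma (in linear_map) image_finsum:
  assumes "\<And>i. i \<in> I \<Longrightarrow> g i \<in> carrier V"
  shows "T (\<Oplus>\<^bsub>V\<^esub>i\<in>I. g i) = (\<Oplus>\<^bsub>W\<^esub>i\<in>I. T (g i))"
  using assms
proof (induction I rule: infinite_finite_induct)
  case (insert i I)
  then have "T (\<Oplus>\<^bsub>V\<^esub>i\<in>insert i I. g i) = T (g i \<oplus>\<^bsub>V\<^esub> (\<Oplus>\<^bsub>V\<^esub>i\<in>I. g i))"
    by (subst V.finsum_insert') auto
  also have "\<dots> = T (g i) \<oplus>\<^bsub>W\<^esub> T (\<Oplus>\<^bsub>V\<^esub>i\<in>I. g i)"
    using insert by (intro T_add V.finsum_carrier) auto
  also have "\<dots> = (\<Oplus>\<^bsub>W\<^esub>i\<in>insert i I. T (g i))"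
    using insert by (subst W.finsum_insert') auto
  finally show ?case .
qed auto

lemma (in linear_map) image_sumset:
  assumes X: "\<And>i. i \<in> I \<Longrightarrow> X i \<subseteq> carrier V"
  shows "T ` sumset V I X = sumset W I (\<lambda>i. T ` X i)"
proof
  show "T ` sumset V I X \<subseteq> sumset W I (\<lambda>i. T ` X i)"
  proof
    fix u assume "u \<in> T ` sumset V I X"
    then obtain f where f: "\<And>i. i \<in> I \<Longrightarrow> f i \<in> X i" "u = T (\<Oplus>\<^bsub>V\<^esub>i\<in>I. f i)"
      by (blast elim: sumsetE)
    have "u = (\<Oplus>\<^bsub>W\<^esub>i\<in>I. T (f i))" unfolding f(2) using f(1) X by (intro image_finsum) auto
    moreover have "(\<Oplus>\<^bsub>W\<^esub>i\<in>I. T (f i)) \<in> sumset W I (\<lambda>i. T ` X i)"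
      by (rule W.sumset_mem) (use f(1) X in auto)
    ultimately show "u \<in> sumset W I (\<lambda>i. T ` X i)" by simp
  qed
  show "sumset W I (\<lambda>i. T ` X i) \<subseteq> T ` sumset V I X"
  proof
    fix u assume "u \<in> sumset W I (\<lambda>i. T ` X i)"
    then obtain g where g: "\<And>i. i \<in> I \<Longrightarrow> g i \<in> T ` X i" "u = (\<Oplus>\<^bsub>W\<^esub>i\<in>I. g i)"
      by (metis sumsetE)
    \<comment> \<open>Preimages are chosen inside the respective component.\<close>
    define f where "f i = inv_into (X i) T (g i)" for i
    have f: "f i \<in> X i \<and> g i = T (f i)" if "i \<in> I" for i
      unfolding f_def using g(1)[OF that] by (simp add: inv_into_into f_inv_into_f)
    have "u = (\<Oplus>\<^bsub>W\<^esub>i\<in>I. T (f i))" unfolding g(2)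
      using f X by (intro W.finsum_cong_carrier) auto
    also have "\<dots> = T (\<Oplus>\<^bsub>V\<^esub>i\<in>I. f i)" using f X by (intro image_finsum[symmetric]) auto
    finally show "u \<in> T ` sumset V I X" using V.sumset_mem[of I f X] f X by blast
  qed
qed

section \<open>Smaller scalar fields for finite spaces, linear maps and spans\<close>

lemma (in finite_vectorspace) finite_vectorspace_restrict_scalars:
  assumes "subfield F K"
  shows "finite_vectorspace (K\<lparr>carrier := F\<rparr>) V"
  using restrict_scalars[OF assms] finite_carrier finite_subset[OF subfieldE(3)[OF assms] finite_scalars]
  by (simp add: finite_vectorspace_def finite_vectorspace_axioms_def)

lemma (in linear_map) linear_map_restrict_scalars:
  assumes "subfield F K"
  shows "linear_map (K\<lparr>carrier := F\<rparr>) V W T"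
proof -
  have "T \<in> LinearCombinations.module_hom (K\<lparr>carrier := F\<rparr>) V W"
    using T_hom subfieldE(3)[OF assms] by (auto simp: LinearCombinations.module_hom_def)
  then show ?thesis
    using V.restrict_scalars[OF assms] W.restrict_scalars[OF assms]
    by (simp add: linear_map_def mod_hom_def mod_hom_axioms_def vectorspace_def)
qed

lemma (in vectorspace) span_restrict_scalars_subset:
  assumes "subfield F K" "S \<subseteq> carrier V"
  shows "lspan (K\<lparr>carrier := F\<rparr>) V S \<subseteq> span S"
  using vectorspace.span_minimal[OF restrict_scalars[OF assms(1)]]
    subspace_restrict_scalars[OF assms(1) span_is_subspace[OF assms(2)]] span_superset[OF assms(2)]
  by blast

section \<open>Dimension formulas by counting\<close>

context finite_vectorspace
begin

lemma subdim_carrier: "subdim K V (carrier V) = dim"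
  by simp

lemma subspace_carrier: "VectorSpace.subspace K (carrier V) V"
  by (simp add: subspace_iff)

lemma subspace_Int:
  "VectorSpace.subspace K X V \<Longrightarrow> VectorSpace.subspace K Y V \<Longrightarrow> VectorSpace.subspace K (X \<inter> Y) V"
  by (auto simp: subspace_iff)

lemma subdim_sumset_le:
  assumes "finite I" and X: "\<And>i. i \<in> I \<Longrightarrow> VectorSpace.subspace K (X i) V"
  shows "subdim K V (sumset V I X) \<le> (\<Sum>i\<in>I. subdim K V (X i))"
proof -
  have "card (sumset V I X) \<le> (\<Prod>i\<in>I. card (X i))"
    using assms finite_subspace by (intro card_sumset_le) auto
  also have "\<dots> = card (carrier K) ^ (\<Sum>i\<in>I. subdim K V (X i))"
    unfolding power_sum using card_subspace[OF X] by (intro prod.cong) auto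
  finally have "card (carrier K) ^ subdim K V (sumset V I X) \<le> card (carrier K) ^ (\<Sum>i\<in>I. subdim K V (X i))"
    using card_subspace[OF sumset_subspace[of I X, OF X]] by simp
  then show ?thesis using card_scalars_gt_1 by simp
qed

text \<open>The equality case of \<open>subdim_sumset_le\<close>: the product of the components and
  their sum then have equally many elements. Both direct sums of the dual decomposition are
  established by this criterion.\<close>

lemma internal_direct_sumI_subdim:
  assumes "finite I" and X: "\<And>i. i \<in> I \<Longrightarrow> VectorSpace.subspace K (X i) V"
    and S: "sumset V I X = S" and d: "subdim K V S = (\<Sum>i\<in>I. subdim K V (X i))"
  shows "internal_direct_sum V S I X"
proof (rule internal_direct_sumI_card[OF assms(1) _ S])
  show "finite (X i)" if "i \<in> I" for i using finite_subspace[OF X[OF that]] .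
  have "card S = card (carrier K) ^ (\<Sum>i\<in>I. subdim K V (X i))"
    using card_subspace[OF sumset_subspace[of I X, OF X]] unfolding S d by simp
  also have "\<dots> = (\<Prod>i\<in>I. card (X i))"
    unfolding power_sum using card_subspace[OF X] by (intro prod.cong) auto
  finally show "card S = (\<Prod>i\<in>I. card (X i))" .
qed

text \<open>A nonzero functional takes every scalar value, so its kernel has index
  \<open>card (carrier K)\<close>. Linearity is demanded on \<open>A\<close> only, which covers
  \<open>\<sigma>\<close> as a \<open>K\<close>-functional on \<open>V\<close> and as an
  \<open>F\<close>-functional on \<open>W\<close>.\<close>

lemma subdim_kernel:
  assumes A: "VectorSpace.subspace K A V"
    and val: "\<And>x. x \<in> A \<Longrightarrow> f x \<in> carrier K"
    and add: "\<And>x y. x \<in> A \<Longrightarrow> y \<in> A \<Longrightarrow> f (x \<oplus>\<^bsub>V\<^esub> y) = f x \<oplus>\<^bsub>K\<^esub> f y"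
    and smult: "\<And>a x. a \<in> carrier K \<Longrightarrow> x \<in> A \<Longrightarrow> f (a \<odot>\<^bsub>V\<^esub> x) = a \<otimes>\<^bsub>K\<^esub> f x"
    and v: "v \<in> A" "f v \<noteq> \<zero>\<^bsub>K\<^esub>"
  shows "subdim K V {x \<in> A. f x = \<zero>\<^bsub>K\<^esub>} + 1 = subdim K V A"
proof -
  have sub: "A \<subseteq> carrier V" using A by (simp add: subspace_iff)
  have f0: "f \<zero>\<^bsub>V\<^esub> = \<zero>\<^bsub>K\<^esub>"
    using smult[of "\<zero>\<^bsub>K\<^esub>" v] v val sub by (simp add: subset_iff)
  have ker: "VectorSpace.subspace K {x \<in> A. f x = \<zero>\<^bsub>K\<^esub>} V"
    using A add smult f0 by (auto simp: subspace_iff)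
  have fm: "f (x \<ominus>\<^bsub>V\<^esub> y) = f x \<ominus>\<^bsub>K\<^esub> f y" if xy: "x \<in> A" "y \<in> A" for x y
  proof -
    have "f x = f ((x \<ominus>\<^bsub>V\<^esub> y) \<oplus>\<^bsub>V\<^esub> y)"
      using xy sub by (simp add: a_minus_def M.a_assoc M.l_neg subset_iff)
    also have "\<dots> = f (x \<ominus>\<^bsub>V\<^esub> y) \<oplus>\<^bsub>K\<^esub> f y" using add subspace_minus[OF A xy] xy by simp
    finally show ?thesis
      using val[OF subspace_minus[OF A xy]] val[OF xy(2)]
      by (simp add: a_minus_def R.a_assoc R.r_neg)
  qed
  have im: "f ` A = carrier K"
  proof (intro equalityI subsetI)
    fix c assume c: "c \<in> carrier K"
    have u: "f v \<in> Units K" using v val by (simp add: field_Units)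
    \<comment> \<open>Scaling \<open>v\<close> by \<open>c\<close> over \<open>f v\<close> yields
      the prescribed value \<open>c\<close>.\<close>
    have "f ((c \<otimes>\<^bsub>K\<^esub> inv\<^bsub>K\<^esub> f v) \<odot>\<^bsub>V\<^esub> v) = c"
      using c u v val[OF v(1)] by (simp add: smult m_assoc)
    moreover have "(c \<otimes>\<^bsub>K\<^esub> inv\<^bsub>K\<^esub> f v) \<odot>\<^bsub>V\<^esub> v \<in> A" using c u v A by (simp add: subspace_iff)
    ultimately show "c \<in> f ` A" by (metis imageI)
  qed (use val in auto)
  have "card A = card (A \<inter> {x \<in> A. f x = \<zero>\<^bsub>K\<^esub>}) * card (f ` A)"
  proof (rule M.card_eq_card_kernel_times_card_image)
    show "finite A" using finite_subspace[OF A] .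
    show "f x = f y \<longleftrightarrow> x \<ominus>\<^bsub>V\<^esub> y \<in> {x \<in> A. f x = \<zero>\<^bsub>K\<^esub>}" if "x \<in> A" "y \<in> A" for x y
      using fm[OF that] subspace_minus[OF A that] val that by (simp add: R.r_right_minus_eq)
  qed (use A subspace_minus[OF A] in \<open>auto simp: subspace_iff\<close>)
  then have "card A = card {x \<in> A. f x = \<zero>\<^bsub>K\<^esub>} * card (carrier K)"
    unfolding im by (simp add: Int_absorb1)
  then have "card (carrier K) ^ (subdim K V {x \<in> A. f x = \<zero>\<^bsub>K\<^esub>} + 1) = card (carrier K) ^ subdim K V A"
    unfolding card_subspace[OF A] card_subspace[OF ker] by simp
  then show ?thesis using card_scalars_gt_1 by (simp only: power_inject_exp)
qed

lemma quot_space_finite_vectorspace: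
  assumes "VectorSpace.subspace K N V"
  shows "finite_vectorspace K (quot_space V N)"
  using quot_space_vectorspace[OF assms] finite_carrier finite_scalars
  by (simp add: finite_vectorspace_def finite_vectorspace_axioms_def quot_space_carrier)

text \<open>Rank-nullity for the coset map on \<open>A\<close>: its fibres there are translates of
  \<open>A \<inter> N\<close>.\<close>

lemma subdim_coset_image:
  assumes N: "VectorSpace.subspace K N V" and A: "VectorSpace.subspace K A V"
  shows "subdim K V A = subdim K V (A \<inter> N) + subdim K (quot_space V N) ((\<lambda>x. N +>\<^bsub>V\<^esub> x) ` A)"
proof -
  interpret P: finite_vectorspace K "quot_space V N" by (rule quot_space_finite_vectorspace[OF N])
  interpret p: linear_map K V "quot_space V N" "\<lambda>x. N +>\<^bsub>V\<^esub> x" by (rule quot_space_proj_linear[OF N])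
  have sub: "A \<subseteq> carrier V" using A by (simp add: subspace_iff)
  have "card A = card (A \<inter> N) * card ((\<lambda>x. N +>\<^bsub>V\<^esub> x) ` A)"
    by (rule M.card_eq_card_kernel_times_card_image)
      (use A sub subspace_minus[OF A] finite_subspace[OF A] coset_eq_iff[OF N] in \<open>auto simp: subspace_iff subset_iff\<close>)
  then have "card (carrier K) ^ subdim K V A = card (carrier K) ^
      (subdim K V (A \<inter> N) + subdim K (quot_space V N) ((\<lambda>x. N +>\<^bsub>V\<^esub> x) ` A))"
    using card_subspace[OF A] card_subspace[OF subspace_Int[OF A N]]
      P.card_subspace[OF p.image_subspace[OF A]] by (simp add: power_add)
  then show ?thesis using card_scalars_gt_1 by (simp only: power_inject_exp)
qed

end

text \<open>Two scalar fields meet here: a difference stays in \<open>A\<close> because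
  \<open>A\<close> is a subspace over \<open>F\<close>, and equal cosets put it into the
  \<open>K\<close>-subspace \<open>N\<close>.\<close>

lemma (in vectorspace) coset_inj_on:
  assumes N: "VectorSpace.subspace K N V" and F: "subfield F K"
    and A: "VectorSpace.subspace (K\<lparr>carrier := F\<rparr>) A V" and "A \<inter> N \<subseteq> {\<zero>\<^bsub>V\<^esub>}"
  shows "inj_on (\<lambda>x. N +>\<^bsub>V\<^esub> x) A"
proof (rule inj_onI)
  interpret E: vectorspace "K\<lparr>carrier := F\<rparr>" V by (rule restrict_scalars[OF F])
  fix x y assume xy: "x \<in> A" "y \<in> A" and eq: "N +>\<^bsub>V\<^esub> x = N +>\<^bsub>V\<^esub> y"
  have c: "x \<in> carrier V" "y \<in> carrier V" using xy A by (auto simp: E.subspace_iff)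
  have "x \<ominus>\<^bsub>V\<^esub> y \<in> A \<inter> N" using E.subspace_minus[OF A xy] coset_eq_iff[OF N c] eq by simp
  then have "x \<ominus>\<^bsub>V\<^esub> y = \<zero>\<^bsub>V\<^esub>" using assms(4) by auto
  moreover have "x = (x \<ominus>\<^bsub>V\<^esub> y) \<oplus>\<^bsub>V\<^esub> y" using c by (simp add: a_minus_def M.a_assoc M.l_neg)
  ultimately show "x = y" using c by simp
qed

lemma (in finite_vectorspace) subdim_span_le:
  assumes "finite B" "B \<subseteq> carrier V"
  shows "subdim K V (span B) \<le> card B"
proof -
  have sp: "VectorSpace.subspace K (span B) V" by (rule span_is_subspace[OF assms(2)])
  interpret S: vectorspace K "V\<lparr>carrier := span B\<rparr>" by (rule subspace_is_vs[OF sp])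
  have B: "B \<subseteq> span B" by (rule span_superset[OF assms(2)])
  have "lspan K (V\<lparr>carrier := span B\<rparr>) B = span B"
    using span_li_not_depend(1)[OF B] sp by simp
  then show ?thesis using S.gen_ge_dim[OF assms(1)] B by simp
qed

text \<open>Injectivity of the summation map, with \<open>f\<close> compared to the zero
  family.\<close>

lemma (in vectorspace) internal_direct_sum_zero:
  assumes ds: "internal_direct_sum V S I X"
    and X: "\<And>i. i \<in> I \<Longrightarrow> VectorSpace.subspace K (X i) V"
    and f: "\<And>i. i \<in> I \<Longrightarrow> f i \<in> X i" "(\<Oplus>\<^bsub>V\<^esub>i\<in>I. f i) = \<zero>\<^bsub>V\<^esub>" and i: "i \<in> I"
  shows "f i = \<zero>\<^bsub>V\<^esub>"
proof -
  have fV: "f j \<in> carrier V" if "j \<in> I" for j using f(1)[OF that] X[OF that] by (auto simp: subspace_iff)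
  have "(\<Oplus>\<^bsub>V\<^esub>i\<in>I. restrict f I i) = (\<Oplus>\<^bsub>V\<^esub>i\<in>I. f i)"
    using fV by (intro finsum_cong_carrier) auto
  also have "\<dots> = (\<Oplus>\<^bsub>V\<^esub>i\<in>I. \<zero>\<^bsub>V\<^esub>)" using f(2) by simp
  also have "\<dots> = (\<Oplus>\<^bsub>V\<^esub>i\<in>I. restrict (\<lambda>_. \<zero>\<^bsub>V\<^esub>) I i)" by (intro finsum_cong_carrier) auto
  finally have eq: "(\<Oplus>\<^bsub>V\<^esub>i\<in>I. restrict f I i) = (\<Oplus>\<^bsub>V\<^esub>i\<in>I. restrict (\<lambda>_. \<zero>\<^bsub>V\<^esub>) I i)" .
  have inj: "inj_on (\<lambda>f. \<Oplus>\<^bsub>V\<^esub>i\<in>I. f i) (\<Pi>\<^sub>E i\<in>I. X i)"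
    using ds by (simp add: internal_direct_sum_def bij_betw_def)
  have "restrict f I = restrict (\<lambda>_. \<zero>\<^bsub>V\<^esub>) I"
  proof (rule inj_onD[OF inj])
    show "(\<Oplus>\<^bsub>V\<^esub>i\<in>I. restrict f I i) = (\<Oplus>\<^bsub>V\<^esub>i\<in>I. restrict (\<lambda>_. \<zero>\<^bsub>V\<^esub>) I i)" by (rule eq)
    show "restrict f I \<in> Pi\<^sub>E I X" unfolding restrict_PiE_iff using f(1) by blast
    show "restrict (\<lambda>_. \<zero>\<^bsub>V\<^esub>) I \<in> Pi\<^sub>E I X" unfolding restrict_PiE_iff using X by (simp add: subspace_iff)
  qed
  then show ?thesis using i by (metis restrict_apply')
qed

lemma sumset_cong: "(\<And>i. i \<in> I \<Longrightarrow> X i = Y i) \<Longrightarrow> sumset V I X = sumset V I Y"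
  unfolding sumset_def by (simp cong: PiE_cong)

section \<open>Forms rational over a subfield\<close>

text \<open>The extension of a form on \<open>W\<close> is described without naming that form: on
  \<open>W\<close> the values of \<open>\<sigma>\<close> lie in \<open>F\<close> and
  \<open>\<sigma>\<close> is non-degenerate in its second argument. Non-degeneracy in the first
  argument on all of \<open>V\<close> is derived in \<open>nondegenerate_left\<close>.\<close>

locale rational_form = finite_vectorspace K V
  for K :: "('a, 'b) ring_scheme" and V :: "('a, 'v, 'c) module_scheme" +
  fixes F :: "'a set" and W :: "'v set" and \<sigma> :: "'v \<Rightarrow> 'v \<Rightarrow> 'a"
  assumes F: "subfield F K"
    and W: "VectorSpace.subspace (K\<lparr>carrier := F\<rparr>) W V"
    and span_W: "lspan K V W = carrier V"
    and bilinear: "bilinear_form K V \<sigma>"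
    and rational: "\<And>x y. x \<in> W \<Longrightarrow> y \<in> W \<Longrightarrow> \<sigma> x y \<in> F"
    and nondegenerate: "\<And>y. y \<in> W \<Longrightarrow> (\<And>x. x \<in> W \<Longrightarrow> \<sigma> x y = \<zero>\<^bsub>K\<^esub>) \<Longrightarrow> y = \<zero>\<^bsub>V\<^esub>"
begin

abbreviation E where "E \<equiv> K\<lparr>carrier := F\<rparr>"

lemma E_finite_vectorspace: "finite_vectorspace E V"
  by (rule finite_vectorspace_restrict_scalars[OF F])

lemmas E_subspace_iff = vectorspace.subspace_iff[OF restrict_scalars[OF F]]

lemma F_subset: "F \<subseteq> carrier K"
  by (rule subfieldE(3)[OF F])

lemma W_subset: "W \<subseteq> carrier V"
  using W by (simp add: E_subspace_iff)

section \<open>Bilinearity and orthogonality to spans\<close>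

lemma form_closed [simp]: "x \<in> carrier V \<Longrightarrow> y \<in> carrier V \<Longrightarrow> \<sigma> x y \<in> carrier K"
  using bilinear by (simp add: bilinear_form_def)

lemma form_add_left [simp]: "x \<in> carrier V \<Longrightarrow> y \<in> carrier V \<Longrightarrow> z \<in> carrier V \<Longrightarrow>
    \<sigma> (x \<oplus>\<^bsub>V\<^esub> y) z = \<sigma> x z \<oplus>\<^bsub>K\<^esub> \<sigma> y z"
  and form_add_right [simp]: "x \<in> carrier V \<Longrightarrow> y \<in> carrier V \<Longrightarrow> z \<in> carrier V \<Longrightarrow>
    \<sigma> z (x \<oplus>\<^bsub>V\<^esub> y) = \<sigma> z x \<oplus>\<^bsub>K\<^esub> \<sigma> z y"
  using bilinear by (simp_all add: bilinear_form_def)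

lemma form_smult_left [simp]: "a \<in> carrier K \<Longrightarrow> x \<in> carrier V \<Longrightarrow> y \<in> carrier V \<Longrightarrow>
    \<sigma> (a \<odot>\<^bsub>V\<^esub> x) y = a \<otimes>\<^bsub>K\<^esub> \<sigma> x y"
  and form_smult_right [simp]: "a \<in> carrier K \<Longrightarrow> x \<in> carrier V \<Longrightarrow> y \<in> carrier V \<Longrightarrow>
    \<sigma> x (a \<odot>\<^bsub>V\<^esub> y) = a \<otimes>\<^bsub>K\<^esub> \<sigma> x y"
  using bilinear unfolding bilinear_form_def by blast+

lemma form_zero_left [simp]: "y \<in> carrier V \<Longrightarrow> \<sigma> \<zero>\<^bsub>V\<^esub> y = \<zero>\<^bsub>K\<^esub>"
  using form_smult_left[of "\<zero>\<^bsub>K\<^esub>" "\<zero>\<^bsub>V\<^esub>" y] by simp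

lemma form_zero_right [simp]: "x \<in> carrier V \<Longrightarrow> \<sigma> x \<zero>\<^bsub>V\<^esub> = \<zero>\<^bsub>K\<^esub>"
  using form_smult_right[of "\<zero>\<^bsub>K\<^esub>" x "\<zero>\<^bsub>V\<^esub>"] by simp

lemma minus_add_cancel: "x \<in> carrier V \<Longrightarrow> y \<in> carrier V \<Longrightarrow> (x \<ominus>\<^bsub>V\<^esub> y) \<oplus>\<^bsub>V\<^esub> y = x"
  by (simp add: a_minus_def M.a_assoc M.l_neg)

lemma form_eq_iff_left:
  assumes "x \<in> carrier V" "y \<in> carrier V" "z \<in> carrier V"
  shows "\<sigma> x z = \<sigma> y z \<longleftrightarrow> \<sigma> (x \<ominus>\<^bsub>V\<^esub> y) z = \<zero>\<^bsub>K\<^esub>"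
proof -
  have "\<sigma> x z = \<sigma> (x \<ominus>\<^bsub>V\<^esub> y) z \<oplus>\<^bsub>K\<^esub> \<sigma> y z"
    using form_add_left[of "x \<ominus>\<^bsub>V\<^esub> y" y z] assms by (simp add: minus_add_cancel)
  then show ?thesis using assms by simp
qed

lemma form_eq_iff_right:
  assumes "x \<in> carrier V" "y \<in> carrier V" "z \<in> carrier V"
  shows "\<sigma> z x = \<sigma> z y \<longleftrightarrow> \<sigma> z (x \<ominus>\<^bsub>V\<^esub> y) = \<zero>\<^bsub>K\<^esub>"
proof -
  have "\<sigma> z x = \<sigma> z (x \<ominus>\<^bsub>V\<^esub> y) \<oplus>\<^bsub>K\<^esub> \<sigma> z y"
    using form_add_right[of "x \<ominus>\<^bsub>V\<^esub> y" y z] assms by (simp add: minus_add_cancel)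
  then show ?thesis using assms by simp
qed

lemma form_finsum_left:
  assumes "y \<in> carrier V" "\<And>i. i \<in> I \<Longrightarrow> f i \<in> carrier V"
  shows "\<sigma> (\<Oplus>\<^bsub>V\<^esub>i\<in>I. f i) y = (\<Oplus>\<^bsub>K\<^esub>i\<in>I. \<sigma> (f i) y)"
  using assms(2)
proof (induction I rule: infinite_finite_induct)
  case (insert i I)
  have "\<sigma> (\<Oplus>\<^bsub>V\<^esub>i\<in>insert i I. f i) y = \<sigma> (f i) y \<oplus>\<^bsub>K\<^esub> \<sigma> (\<Oplus>\<^bsub>V\<^esub>i\<in>I. f i) y"
    using insert assms(1) by (simp add: finsum_insert' finsum_carrier)
  also have "\<dots> = (\<Oplus>\<^bsub>K\<^esub>i\<in>insert i I. \<sigma> (f i) y)"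
    using insert assms(1) by (subst R.finsum_insert) auto
  finally show ?case .
qed (use assms(1) in auto)

lemma form_finsum_right:
  assumes "x \<in> carrier V" "\<And>i. i \<in> I \<Longrightarrow> f i \<in> carrier V"
  shows "\<sigma> x (\<Oplus>\<^bsub>V\<^esub>i\<in>I. f i) = (\<Oplus>\<^bsub>K\<^esub>i\<in>I. \<sigma> x (f i))"
  using assms(2)
proof (induction I rule: infinite_finite_induct)
  case (insert i I)
  have "\<sigma> x (\<Oplus>\<^bsub>V\<^esub>i\<in>insert i I. f i) = \<sigma> x (f i) \<oplus>\<^bsub>K\<^esub> \<sigma> x (\<Oplus>\<^bsub>V\<^esub>i\<in>I. f i)"
    using insert assms(1) by (simp add: finsum_insert' finsum_carrier)
  also have "\<dots> = (\<Oplus>\<^bsub>K\<^esub>i\<in>insert i I. \<sigma> x (f i))"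
    using insert assms(1) by (subst R.finsum_insert) auto
  finally show ?case .
qed (use assms(1) in auto)

lemma left_kernel_subspace:
  "y \<in> carrier V \<Longrightarrow> VectorSpace.subspace K {x \<in> carrier V. \<sigma> x y = \<zero>\<^bsub>K\<^esub>} V"
  by (auto simp: subspace_iff)

lemma orth_compl_subspace:
  "X \<subseteq> carrier V \<Longrightarrow> VectorSpace.subspace K (orth_compl K V \<sigma> X) V"
  by (auto simp: subspace_iff orth_compl_def subset_iff)

lemma form_zero_on_span_left:
  assumes "S \<subseteq> carrier V" "y \<in> carrier V" "\<And>x. x \<in> S \<Longrightarrow> \<sigma> x y = \<zero>\<^bsub>K\<^esub>" "x \<in> span S"
  shows "\<sigma> x y = \<zero>\<^bsub>K\<^esub>"
  using span_minimal[OF left_kernel_subspace[OF assms(2)], of S] assms by blast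

lemma form_zero_on_span_right:
  assumes "S \<subseteq> carrier V" "x \<in> carrier V" "\<And>y. y \<in> S \<Longrightarrow> \<sigma> x y = \<zero>\<^bsub>K\<^esub>" "y \<in> span S"
  shows "\<sigma> x y = \<zero>\<^bsub>K\<^esub>"
  using span_minimal[OF orth_compl_subspace[of "{x}"], of S] assms by (auto simp: orth_compl_def)

lemma form_zero_on_E_span_left:
  assumes "S \<subseteq> carrier V" "y \<in> carrier V" "\<And>x. x \<in> S \<Longrightarrow> \<sigma> x y = \<zero>\<^bsub>K\<^esub>" "x \<in> lspan E V S"
  shows "\<sigma> x y = \<zero>\<^bsub>K\<^esub>"
  using form_zero_on_span_left[OF assms(1-3)] span_restrict_scalars_subset[OF F assms(1)] assms(4) by blast

text \<open>Pairing with the bases of all components embeds \<open>W\<close> into the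
  \<open>F\<close>-valued families, by non-degeneracy. Both sides have \<open>card F\<close> to the
  power \<open>dim W\<close> elements, so every prescribed family of values is attained by a vector
  of \<open>W\<close>.\<close>

lemma dual_vectors:
  assumes I: "finite I" and Ws: "\<And>i. i \<in> I \<Longrightarrow> VectorSpace.subspace E (Ws i) V"
    and sum: "sumset V I Ws = W"
    and dims: "(\<Sum>i\<in>I. subdim E V (Ws i)) = subdim E V W"
  shows "\<exists>Bs. (\<forall>i\<in>I. finite (Bs i) \<and> Bs i \<subseteq> Ws i \<and> lspan E V (Bs i) = Ws i \<and>
        card (Bs i) = subdim E V (Ws i)) \<and>
      (\<forall>w\<in>W. \<forall>w'\<in>W. (\<forall>i\<in>I. \<forall>b\<in>Bs i. \<sigma> b w = \<sigma> b w') \<longrightarrow> w = w') \<and>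
      (\<forall>g. (\<forall>i\<in>I. \<forall>b\<in>Bs i. g i b \<in> F) \<longrightarrow> (\<exists>w\<in>W. \<forall>i\<in>I. \<forall>b\<in>Bs i. \<sigma> b w = g i b))"
proof -
  interpret E: finite_vectorspace E V by (rule E_finite_vectorspace)
  have "\<exists>B. finite B \<and> B \<subseteq> Ws i \<and> lspan E V B = Ws i \<and> card B = subdim E V (Ws i)" if "i \<in> I" for i
    using E.subspace_basis[OF Ws[OF that]] by metis
  then obtain Bs where Bs: "\<And>i. i \<in> I \<Longrightarrow>
      finite (Bs i) \<and> Bs i \<subseteq> Ws i \<and> lspan E V (Bs i) = Ws i \<and> card (Bs i) = subdim E V (Ws i)"
    by metis
  have WsV: "Ws i \<subseteq> carrier V" if "i \<in> I" for i using Ws[OF that] by (simp add: E_subspace_iff)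
  have BsV: "Bs i \<subseteq> carrier V" if "i \<in> I" for i using Bs[OF that] WsV[OF that] by blast
  have WsW: "Ws i \<subseteq> W" if "i \<in> I" for i
  proof
    fix x assume "x \<in> Ws i"
    then have "x \<in> sumset V I Ws"
      using I that WsV Ws by (intro sumset_component) (auto simp: E_subspace_iff)
    then show "x \<in> W" by (simp add: sum)
  qed
  have BsW: "b \<in> W" if "i \<in> I" "b \<in> Bs i" for i b using Bs WsW that by blast
  \<comment> \<open>Orthogonality to the bases spreads to the components, then to their sum
    \<open>W\<close>.\<close>
  have zero: "w = \<zero>\<^bsub>V\<^esub>" if w: "w \<in> W" and 0: "\<And>i b. i \<in> I \<Longrightarrow> b \<in> Bs i \<Longrightarrow> \<sigma> b w = \<zero>\<^bsub>K\<^esub>" for w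
  proof (rule nondegenerate[OF w])
    fix x assume "x \<in> W"
    then obtain f where f: "\<And>i. i \<in> I \<Longrightarrow> f i \<in> Ws i" "x = (\<Oplus>\<^bsub>V\<^esub>i\<in>I. f i)"
      unfolding sum[symmetric] by (metis sumsetE)
    have wV: "w \<in> carrier V" using w W_subset by blast
    have "\<sigma> (f i) w = \<zero>\<^bsub>K\<^esub>" if i: "i \<in> I" for i
      by (rule form_zero_on_E_span_left[OF BsV[OF i] wV]) (use 0 f(1) Bs i in auto)
    then have "f i \<in> {x \<in> carrier V. \<sigma> x w = \<zero>\<^bsub>K\<^esub>}" if "i \<in> I" for i using f(1) WsV that by blast
    then have "x \<in> {x \<in> carrier V. \<sigma> x w = \<zero>\<^bsub>K\<^esub>}"
      unfolding f(2) by (rule subspace_finsum[OF left_kernel_subspace[OF wV]])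
    then show "\<sigma> x w = \<zero>\<^bsub>K\<^esub>" by simp
  qed
  have uniq: "w = w'" if w: "w \<in> W" "w' \<in> W"
    and eq: "\<And>i b. i \<in> I \<Longrightarrow> b \<in> Bs i \<Longrightarrow> \<sigma> b w = \<sigma> b w'" for w w'
  proof -
    have c: "w \<in> carrier V" "w' \<in> carrier V" using w W_subset by auto
    have "w \<ominus>\<^bsub>V\<^esub> w' = \<zero>\<^bsub>V\<^esub>"
    proof (rule zero[OF E.subspace_minus[OF W w]])
      fix i b assume ib: "i \<in> I" "b \<in> Bs i"
      then have "b \<in> carrier V" using BsV by blast
      then show "\<sigma> b (w \<ominus>\<^bsub>V\<^esub> w') = \<zero>\<^bsub>K\<^esub>" using form_eq_iff_right[OF c] eq[OF ib] by simp
    qed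
    then show ?thesis using minus_add_cancel[OF c] c by simp
  qed
  \<comment> \<open>Indexing by pairs makes the size of \<open>J\<close> the sum of the component
    dimensions without first showing the bases disjoint.\<close>
  define J where "J = (SIGMA i:I. Bs i)"
  define \<phi> where "\<phi> w = (\<lambda>j\<in>J. \<sigma> (snd j) w)" for w
  have J: "finite J" unfolding J_def using I Bs by auto
  have cardJ: "card J = subdim E V W"
    unfolding J_def using I Bs dims by simp
  have inj: "inj_on \<phi> W"
  proof (rule inj_onI, rule uniq)
    fix w w' i b assume "\<phi> w = \<phi> w'" "i \<in> I" "b \<in> Bs i"
    then have "\<phi> w (i, b) = \<phi> w' (i, b)" "(i, b) \<in> J" by (auto simp: J_def)
    then show "\<sigma> b w = \<sigma> b w'" by (simp add: \<phi>_def)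
  qed
  have sub: "\<phi> ` W \<subseteq> J \<rightarrow>\<^sub>E F"
  proof
    fix f assume "f \<in> \<phi> ` W"
    then obtain w where w: "w \<in> W" "f = \<phi> w" by blast
    have "\<sigma> (snd j) w \<in> F" if "j \<in> J" for j
      using that rational[OF _ w(1)] BsW by (auto simp: J_def)
    then show "f \<in> J \<rightarrow>\<^sub>E F" unfolding w(2) \<phi>_def restrict_PiE_iff by blast
  qed
  have "card (J \<rightarrow>\<^sub>E F) = card W"
    using E.card_subspace[OF W] card_PiE[OF J, of "\<lambda>_. F"] by (simp add: cardJ)
  \<comment> \<open>An injective image of full size is the whole finite set.\<close>
  then have surj: "\<phi> ` W = J \<rightarrow>\<^sub>E F"
    using sub card_image[OF inj] J finite_subset[OF F_subset finite_scalars]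
    by (intro card_subset_eq finite_PiE) auto
  have "\<exists>w\<in>W. \<forall>i\<in>I. \<forall>b\<in>Bs i. \<sigma> b w = g i b"
    if g: "\<forall>i\<in>I. \<forall>b\<in>Bs i. g i b \<in> F" for g
  proof -
    have "(\<lambda>j\<in>J. g (fst j) (snd j)) \<in> \<phi> ` W" unfolding surj restrict_PiE_iff using g by (auto simp: J_def)
    then obtain w where w: "w \<in> W" "(\<lambda>j\<in>J. g (fst j) (snd j)) = \<phi> w" by auto
    have "\<sigma> b w = g i b" if "i \<in> I" "b \<in> Bs i" for i b
      using fun_cong[OF w(2), of "(i, b)"] that by (simp add: J_def \<phi>_def)
    then show ?thesis using w(1) by blast
  qed
  moreover have "\<forall>w\<in>W. \<forall>w'\<in>W. (\<forall>i\<in>I. \<forall>b\<in>Bs i. \<sigma> b w = \<sigma> b w') \<longrightarrow> w = w'"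
    by (intro ballI impI uniq) auto
  ultimately show ?thesis using Bs by (intro exI[of _ Bs] conjI) auto
qed

text \<open>An \<open>F\<close>-basis of \<open>W\<close> spans \<open>V\<close> over
  \<open>K\<close>, and dual vectors in \<open>W\<close> read off the coefficients of
  \<open>x\<close> one at a time. If \<open>x\<close> is orthogonal to \<open>W\<close>, all of them
  vanish.\<close>

lemma nondegenerate_left:
  assumes x: "x \<in> carrier V" and 0: "\<And>w. w \<in> W \<Longrightarrow> \<sigma> x w = \<zero>\<^bsub>K\<^esub>"
  shows "x = \<zero>\<^bsub>V\<^esub>"
proof -
  interpret E: finite_vectorspace E V by (rule E_finite_vectorspace)
  \<comment> \<open>\<open>dual_vectors\<close> will be applied to the family with \<open>W\<close>
    as its only component, indexed by the unit type.\<close>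
  have S: "sumset V {()} (\<lambda>_. W) = W"
  proof
    show "sumset V {()} (\<lambda>_. W) \<subseteq> W"
    proof
      fix v assume "v \<in> sumset V {()} (\<lambda>_. W)"
      then obtain f where f: "\<And>i. i \<in> {()} \<Longrightarrow> f i \<in> W" "v = (\<Oplus>\<^bsub>V\<^esub>i\<in>{()}. f i)" by (metis sumsetE)
      show "v \<in> W" unfolding f(2) by (rule E.subspace_finsum[OF W f(1)])
    qed
    show "W \<subseteq> sumset V {()} (\<lambda>_. W)"
    proof
      fix w assume w: "w \<in> W"
      have "(\<Oplus>\<^bsub>V\<^esub>i\<in>{()}. w) \<in> sumset V {()} (\<lambda>_. W)" by (rule sumset_mem) (use w W_subset in blast)+
      moreover have "(\<Oplus>\<^bsub>V\<^esub>i\<in>{()}. w) = w"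
      proof -
        have "w \<in> carrier V" using w W_subset by blast
        then show ?thesis using finsum_insert'[of "{}" "()" "\<lambda>_. w"] by simp
      qed
      ultimately show "w \<in> sumset V {()} (\<lambda>_. W)" by simp
    qed
  qed
  have d: "(\<Sum>i\<in>{()}. subdim E V W) = subdim E V W" by simp
  have fin: "finite {()}" by (rule finite.intros)+
  from dual_vectors[of "{()}" "\<lambda>_. W", OF fin W S d] obtain Bs where
    H: "\<forall>i\<in>{()}. finite (Bs i) \<and> Bs i \<subseteq> W \<and> lspan E V (Bs i) = W \<and> card (Bs i) = subdim E V W"
    and dual: "\<forall>g. (\<forall>i\<in>{()}. \<forall>b\<in>Bs i. g i b \<in> F) \<longrightarrow>
      (\<exists>w\<in>W. \<forall>i\<in>{()}. \<forall>b\<in>Bs i. \<sigma> b w = g i b)"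
    by (elim exE conjE) (rule that)
  define B where "B = Bs ()"
  have Bs: "finite B" "B \<subseteq> W" "lspan E V B = W" using H unfolding B_def by blast+
  have BV: "B \<subseteq> carrier V" using Bs W_subset by auto
  have fB: "finite B" using Bs by simp
  have "W \<subseteq> span B" using span_restrict_scalars_subset[OF F BV] Bs by simp
  then have "carrier V \<subseteq> span B"
    using span_minimal[OF span_is_subspace[OF BV]] span_W by metis
  then obtain a where a: "a \<in> B \<rightarrow> carrier K" "lincomb a B = x"
    using finite_in_span[OF fB BV] x by blast
  have "a b0 = \<zero>\<^bsub>K\<^esub>" if b0: "b0 \<in> B" for b0
  proof -
    have "\<one>\<^bsub>K\<^esub> \<in> F" "\<zero>\<^bsub>K\<^esub> \<in> F" using subringE(2,3)[OF subfieldE(1)[OF F]] by auto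
    \<comment> \<open>The vector dual to \<open>b0\<close>; pairing \<open>x\<close> with it leaves
      only the coefficient \<open>a b0\<close>.\<close>
    then obtain w where w: "w \<in> W" "\<And>b. b \<in> B \<Longrightarrow> \<sigma> b w = (if b0 = b then \<one>\<^bsub>K\<^esub> else \<zero>\<^bsub>K\<^esub>)"
      using dual[THEN spec, of "\<lambda>_ b. if b0 = b then \<one>\<^bsub>K\<^esub> else \<zero>\<^bsub>K\<^esub>"] by (auto simp: B_def)
    have wV: "w \<in> carrier V" using w W_subset by auto
    have "\<sigma> x w = (\<Oplus>\<^bsub>K\<^esub>b\<in>B. \<sigma> (a b \<odot>\<^bsub>V\<^esub> b) w)"
      unfolding a(2)[symmetric] lincomb_def using a(1) BV wV by (intro form_finsum_left) auto
    also have "\<dots> = (\<Oplus>\<^bsub>K\<^esub>b\<in>B. if b0 = b then a b else \<zero>\<^bsub>K\<^esub>)"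
    proof (rule R.finsum_cong'[OF refl])
      show "(\<lambda>b. if b0 = b then a b else \<zero>\<^bsub>K\<^esub>) \<in> B \<rightarrow> carrier K" using a(1) by auto
      show "\<sigma> (a b \<odot>\<^bsub>V\<^esub> b) w = (if b0 = b then a b else \<zero>\<^bsub>K\<^esub>)" if b: "b \<in> B" for b
      proof -
        have "a b \<in> carrier K" "b \<in> carrier V" using a(1) BV b by auto
        then show ?thesis using wV w(2)[OF b] by simp
      qed
    qed
    also have "\<dots> = a b0" using b0 fB a(1) by (intro R.add.finprod_singleton) auto
    finally show ?thesis using 0[OF w(1)] by simp
  qed
  then have "lincomb a B = (\<Oplus>\<^bsub>V\<^esub>b\<in>B. \<zero>\<^bsub>V\<^esub>)"
    unfolding lincomb_def using BV by (intro finsum_cong_carrier) auto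
  then show ?thesis using a(2) by simp
qed

text \<open>The condition is on the second argument of \<open>\<sigma>\<close>, the side used by
  \<open>orth_compl\<close>.\<close>

definition dual_component :: "'i set \<Rightarrow> ('i \<Rightarrow> 'v set) \<Rightarrow> 'i \<Rightarrow> 'v set" where
  "dual_component I Ws i = {w \<in> W. \<forall>j\<in>I - {i}. \<forall>x\<in>Ws j. \<sigma> x w = \<zero>\<^bsub>K\<^esub>}"

lemma dual_component_subspace:
  assumes "\<And>j. j \<in> I \<Longrightarrow> Ws j \<subseteq> carrier V"
  shows "VectorSpace.subspace E (dual_component I Ws i) V"
proof -
  interpret E: finite_vectorspace E V by (rule E_finite_vectorspace)
  have "dual_component I Ws i = W \<inter> orth_compl K V \<sigma> (\<Union>j\<in>I - {i}. Ws j)"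
    using W_subset by (auto simp: dual_component_def orth_compl_def)
  moreover have "VectorSpace.subspace E (orth_compl K V \<sigma> (\<Union>j\<in>I - {i}. Ws j)) V"
    using assms by (intro subspace_restrict_scalars[OF F] orth_compl_subspace) auto
  ultimately show ?thesis using E.subspace_Int[OF W] by simp
qed

text \<open>A vector of \<open>W\<close> splits according to the component whose basis it is paired
  with, so the dual components generate \<open>W\<close>. One of them is determined by its pairings
  with the basis of \<open>Ws i\<close> alone, which bounds its dimension by that of
  \<open>Ws i\<close>; comparing the sums forces equality.\<close>

lemma dual_component:
  assumes I: "finite I" and Ws: "\<And>i. i \<in> I \<Longrightarrow> VectorSpace.subspace E (Ws i) V"
    and sum: "sumset V I Ws = W"
    and dims: "(\<Sum>i\<in>I. subdim E V (Ws i)) = subdim E V W"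
  shows sumset_dual_component: "sumset V I (dual_component I Ws) = W"
    and subdim_dual_component: "i \<in> I \<Longrightarrow> subdim E V (dual_component I Ws i) = subdim E V (Ws i)"
proof -
  interpret E: finite_vectorspace E V by (rule E_finite_vectorspace)
  obtain Bs where
    Bs: "\<forall>i\<in>I. finite (Bs i) \<and> Bs i \<subseteq> Ws i \<and> lspan E V (Bs i) = Ws i \<and> card (Bs i) = subdim E V (Ws i)"
    and uniq: "\<forall>w\<in>W. \<forall>w'\<in>W. (\<forall>i\<in>I. \<forall>b\<in>Bs i. \<sigma> b w = \<sigma> b w') \<longrightarrow> w = w'"
    and dual: "\<forall>g. (\<forall>i\<in>I. \<forall>b\<in>Bs i. g i b \<in> F) \<longrightarrow> (\<exists>w\<in>W. \<forall>i\<in>I. \<forall>b\<in>Bs i. \<sigma> b w = g i b)"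
    by (rule exE[OF dual_vectors[OF I Ws sum dims]]) (assumption, elim conjE, rule that)
  have WsV: "Ws i \<subseteq> carrier V" if "i \<in> I" for i using Ws[OF that] by (simp add: E_subspace_iff)
  have BsV: "Bs i \<subseteq> carrier V" if "i \<in> I" for i using Bs WsV[OF that] that by blast
  have WsW: "x \<in> W" if "i \<in> I" "x \<in> Ws i" for i x
  proof -
    have "x \<in> sumset V I Ws"
      using I that WsV Ws by (intro sumset_component) (auto simp: E_subspace_iff)
    then show "x \<in> W" by (simp add: sum)
  qed
  let ?D = "dual_component I Ws"
  have D: "VectorSpace.subspace E (?D i) V" for i using WsV by (rule dual_component_subspace)
  have DW: "?D i \<subseteq> W" for i by (auto simp: dual_component_def)
  show sumD: "sumset V I ?D = W"
  proof (intro equalityI subsetI)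
    fix v assume "v \<in> sumset V I ?D"
    then obtain f where f: "\<And>i. i \<in> I \<Longrightarrow> f i \<in> ?D i" "v = (\<Oplus>\<^bsub>V\<^esub>i\<in>I. f i)" by (metis sumsetE)
    have "f i \<in> W" if "i \<in> I" for i using f(1)[OF that] DW by blast
    then show "v \<in> W" unfolding f(2) by (rule E.subspace_finsum[OF W])
  next
    fix w assume w: "w \<in> W"
    \<comment> \<open>The part of \<open>w\<close> belonging to \<open>i\<close>: it copies the
      pairings of \<open>w\<close> with the basis of \<open>Ws i\<close> and pairs to zero with the
      other bases.\<close>
    have "\<exists>u\<in>W. \<forall>j\<in>I. \<forall>b\<in>Bs j. \<sigma> b u = (if i = j then \<sigma> b w else \<zero>\<^bsub>K\<^esub>)" for i
    proof -
      have "\<forall>j\<in>I. \<forall>b\<in>Bs j. (if i = j then \<sigma> b w else \<zero>\<^bsub>K\<^esub>) \<in> F"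
        using Bs WsW rational[OF _ w] subringE(2)[OF subfieldE(1)[OF F]] by (simp, blast)
      then show ?thesis using dual[THEN spec, of "\<lambda>j b. if i = j then \<sigma> b w else \<zero>\<^bsub>K\<^esub>"] by blast
    qed
    then obtain u where uW: "\<And>i. u i \<in> W"
      and u: "\<And>i j b. j \<in> I \<Longrightarrow> b \<in> Bs j \<Longrightarrow> \<sigma> b (u i) = (if i = j then \<sigma> b w else \<zero>\<^bsub>K\<^esub>)"
      by metis
    have uV: "u i \<in> carrier V" for i using uW W_subset by blast
    have uD: "u i \<in> ?D i" for i
      unfolding dual_component_def
    proof (intro CollectI conjI ballI uW)
      fix j x assume j: "j \<in> I - {i}" and x: "x \<in> Ws j"
      show "\<sigma> x (u i) = \<zero>\<^bsub>K\<^esub>"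
      proof (rule form_zero_on_E_span_left[OF BsV uV])
        show "x \<in> lspan E V (Bs j)" using Bs j x by auto
        show "\<sigma> b (u i) = \<zero>\<^bsub>K\<^esub>" if "b \<in> Bs j" for b using u that j by auto
      qed (use j in auto)
    qed
    have sW: "(\<Oplus>\<^bsub>V\<^esub>i\<in>I. u i) \<in> W" by (rule E.subspace_finsum[OF W uW])
    have "\<sigma> b (\<Oplus>\<^bsub>V\<^esub>i\<in>I. u i) = \<sigma> b w" if j: "j \<in> I" "b \<in> Bs j" for j b
    proof -
      have b: "b \<in> carrier V" using BsV j by blast
      have "\<sigma> b (\<Oplus>\<^bsub>V\<^esub>i\<in>I. u i) = (\<Oplus>\<^bsub>K\<^esub>i\<in>I. \<sigma> b (u i))" by (rule form_finsum_right[OF b uV])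
      also have "\<dots> = (\<Oplus>\<^bsub>K\<^esub>i\<in>I. if j = i then \<sigma> b w else \<zero>\<^bsub>K\<^esub>)"
        using b w W_subset u[OF j] by (intro R.finsum_cong') auto
      also have "\<dots> = \<sigma> b w"
        using I j b w W_subset by (intro R.add.finprod_singleton) auto
      finally show ?thesis .
    qed
    then have "(\<Oplus>\<^bsub>V\<^esub>i\<in>I. u i) = w" using uniq sW w by blast
    moreover have "(\<Oplus>\<^bsub>V\<^esub>i\<in>I. u i) \<in> sumset V I ?D"
      by (rule sumset_mem) (use uD DW W_subset in blast)+
    ultimately show "w \<in> sumset V I ?D" by simp
  qed
  have le: "subdim E V (?D i) \<le> subdim E V (Ws i)" if i: "i \<in> I" for i
  proof -
    have "card (id ` ?D i) \<le> card F ^ card (Bs i)"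
    proof (rule card_image_le_pow[where f = "\<lambda>w b. \<sigma> b w"])
      show "finite (Bs i)" using Bs i by blast
      show "finite F" using finite_subset[OF F_subset finite_scalars] .
      show "finite (?D i)" using E.finite_subspace[OF D] .
      show "\<sigma> b w \<in> F" if "w \<in> ?D i" "b \<in> Bs i" for w b
        using that DW Bs WsW i by (intro rational) blast+
      show "id w = id w'" if w: "w \<in> ?D i" "w' \<in> ?D i" and eq: "\<And>b. b \<in> Bs i \<Longrightarrow> \<sigma> b w = \<sigma> b w'" for w w'
      proof -
        \<comment> \<open>For \<open>j\<close> other than \<open>i\<close> both pairings vanish by
          the definition of the dual component.\<close>
        have "\<sigma> b w = \<sigma> b w'" if j: "j \<in> I" "b \<in> Bs j" for j b
        proof (cases "j = i")
          case True
          then show ?thesis using eq j by simp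
        next
          case False
          then have "b \<in> Ws j" "j \<in> I - {i}" using Bs j by auto
          then show ?thesis using w by (simp add: dual_component_def)
        qed
        then have "w = w'" using uniq w DW by blast
        then show ?thesis by simp
      qed
    qed
    then have "card F ^ subdim E V (?D i) \<le> card F ^ subdim E V (Ws i)"
      using E.card_subspace[OF D] Bs i by simp
    then show ?thesis using E.card_scalars_gt_1 by simp
  qed
  \<comment> \<open>Generation of \<open>W\<close> bounds the total from below, \<open>le\<close>
    bounds it termwise from above, so no term can be strictly smaller.\<close>
  have "subdim E V W \<le> (\<Sum>i\<in>I. subdim E V (?D i))"
    using E.subdim_sumset_le[of I ?D, OF I D] by (simp add: sumD)
  then have "(\<Sum>i\<in>I. subdim E V (?D i)) = (\<Sum>i\<in>I. subdim E V (Ws i))"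
    using sum_mono[of I "\<lambda>i. subdim E V (?D i)" "\<lambda>i. subdim E V (Ws i)", OF le] dims by simp
  then show "subdim E V (?D i) = subdim E V (Ws i)" if "i \<in> I"
    by (rule sum_mono_inv) (use le that I in auto)
qed

section \<open>From \<open>W\<close> to the quotients of \<open>V\<close>\<close>

lemma subdim_coset_image_rational:
  assumes N: "VectorSpace.subspace K N V" and NW: "W \<inter> N \<subseteq> {\<zero>\<^bsub>V\<^esub>}"
    and X: "VectorSpace.subspace E X V" "X \<subseteq> W"
  shows "subdim E (quot_space V N) ((\<lambda>x. N +>\<^bsub>V\<^esub> x) ` X) = subdim E V X"
proof -
  interpret E: finite_vectorspace E V by (rule E_finite_vectorspace)
  interpret P: finite_vectorspace K "quot_space V N" by (rule quot_space_finite_vectorspace[OF N])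
  interpret p: linear_map K V "quot_space V N" "\<lambda>x. N +>\<^bsub>V\<^esub> x" by (rule quot_space_proj_linear[OF N])
  interpret PE: finite_vectorspace E "quot_space V N" by (rule P.finite_vectorspace_restrict_scalars[OF F])
  interpret pE: linear_map E V "quot_space V N" "\<lambda>x. N +>\<^bsub>V\<^esub> x" by (rule p.linear_map_restrict_scalars[OF F])
  have "inj_on (\<lambda>x. N +>\<^bsub>V\<^esub> x) X" by (rule inj_on_subset[OF coset_inj_on[OF N F W NW] X(2)])
  then show ?thesis
    using PE.subdim_eq_iff[OF pE.image_subspace[OF X(1)]] E.card_subspace[OF X(1)] card_image by metis
qed

text \<open>For \<open>w \<noteq> 0\<close> in \<open>W \<inter> \<Gamma>\<^sup>\<bottom>\<close>, the hyperplane orthogonal to \<open>w\<close> contains \<open>\<Gamma>\<close> and meets \<open>W\<close> in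
  codimension one.\<close>
lemma W_Int_orth_compl:
  assumes \<Gamma>: "VectorSpace.subspace K \<Gamma> V" and \<Gamma>W: "\<Gamma> \<inter> W = {\<zero>\<^bsub>V\<^esub>}"
    and del: "has_delsarte_dual K F (quot_space V \<Gamma>) (quot_image V \<Gamma> W)"
  shows "W \<inter> orth_compl K V \<sigma> \<Gamma> = {\<zero>\<^bsub>V\<^esub>}"
proof (rule ccontr)
  interpret E: finite_vectorspace E V by (rule E_finite_vectorspace)
  let ?P = "quot_space V \<Gamma>" and ?p = "\<lambda>x. \<Gamma> +>\<^bsub>V\<^esub> x"
  interpret P: finite_vectorspace K ?P by (rule quot_space_finite_vectorspace[OF \<Gamma>])
  interpret p: linear_map K V ?P ?p by (rule quot_space_proj_linear[OF \<Gamma>])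
  have oc: "VectorSpace.subspace K (orth_compl K V \<sigma> \<Gamma>) V"
    using \<Gamma> by (intro orth_compl_subspace) (simp add: subspace_iff)
  assume "W \<inter> orth_compl K V \<sigma> \<Gamma> \<noteq> {\<zero>\<^bsub>V\<^esub>}"
  moreover have "\<zero>\<^bsub>V\<^esub> \<in> W \<inter> orth_compl K V \<sigma> \<Gamma>" using W oc by (simp add: E_subspace_iff subspace_iff)
  ultimately obtain w where w: "w \<in> W" "w \<in> orth_compl K V \<sigma> \<Gamma>" "w \<noteq> \<zero>\<^bsub>V\<^esub>" by blast
  have wV: "w \<in> carrier V" using w W_subset by blast
  obtain v where v: "v \<in> W" "\<sigma> v w \<noteq> \<zero>\<^bsub>K\<^esub>" using nondegenerate[OF w(1)] w(3) by blast
  have vV: "v \<in> carrier V" using v W_subset by blast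
  define H where "H = {x \<in> carrier V. \<sigma> x w = \<zero>\<^bsub>K\<^esub>}"
  have H: "VectorSpace.subspace K H V" unfolding H_def by (rule left_kernel_subspace[OF wV])
  have \<Gamma>H: "\<Gamma> \<subseteq> H" using w(2) \<Gamma> by (auto simp: H_def orth_compl_def subspace_iff)
  have "subdim K V H + 1 = subdim K V (carrier V)" unfolding H_def
    by (rule subdim_kernel[OF subspace_carrier]) (use wV v vV in auto)
  moreover have "subdim K V H = subdim K V \<Gamma> + subdim K ?P (?p ` H)"
    using subdim_coset_image[OF \<Gamma> H] \<Gamma>H by (simp add: Int_absorb1)
  moreover have "subdim K V (carrier V) = subdim K V \<Gamma> + P.dim"
    using subdim_coset_image[OF \<Gamma> subspace_carrier] \<Gamma> P.subdim_carrier
    by (simp add: Int_absorb1 subspace_iff quot_space_carrier)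
  \<comment> \<open>Because \<open>H\<close> contains \<open>\<Gamma>\<close>, the dimension of
    \<open>\<Gamma>\<close> cancels and codimension one survives in the quotient.\<close>
  ultimately have hyp: "subdim K ?P (?p ` H) + 1 = P.dim" by linarith
  have WH: "VectorSpace.subspace E (W \<inter> H) V"
    by (rule E.subspace_Int[OF W subspace_restrict_scalars[OF F H]])
  \<comment> \<open>The same functional over the small field: on \<open>W\<close> it has values in
    \<open>F\<close> and is nonzero at \<open>v\<close>.\<close>
  have "subdim E V {x \<in> W. \<sigma> x w = \<zero>\<^bsub>E\<^esub>} + 1 = subdim E V W"
  proof (rule E.subdim_kernel[OF W])
    have c: "x \<in> carrier V" if "x \<in> W" for x using that W_subset by blast
    show "\<sigma> x w \<in> carrier E" if "x \<in> W" for x using rational[OF that w(1)] by simp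
    show "\<sigma> (x \<oplus>\<^bsub>V\<^esub> y) w = \<sigma> x w \<oplus>\<^bsub>E\<^esub> \<sigma> y w" if "x \<in> W" "y \<in> W" for x y
      using c[OF that(1)] c[OF that(2)] wV by simp
    show "\<sigma> (a \<odot>\<^bsub>V\<^esub> x) w = a \<otimes>\<^bsub>E\<^esub> \<sigma> x w" if "a \<in> carrier E" "x \<in> W" for a x
      using c[OF that(2)] that(1) F_subset wV by auto
    show "v \<in> W" by (rule v(1))
    show "\<sigma> v w \<noteq> \<zero>\<^bsub>E\<^esub>" using v(2) by simp
  qed
  moreover have "{x \<in> W. \<sigma> x w = \<zero>\<^bsub>E\<^esub>} = W \<inter> H" using W_subset by (auto simp: H_def)
  ultimately have WH1: "subdim E V (W \<inter> H) + 1 = subdim E V W" by simp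
  have "W \<inter> \<Gamma> \<subseteq> {\<zero>\<^bsub>V\<^esub>}" using \<Gamma>W by blast
  note dim_image = subdim_coset_image_rational[OF \<Gamma> this]
  have U: "quot_image V \<Gamma> W = ?p ` W" by (rule quot_image_eq[OF \<Gamma> W_subset])
  have "?p ` W \<inter> ?p ` H = ?p ` (W \<inter> H)"
  proof (intro equalityI subsetI)
    fix u assume "u \<in> ?p ` W \<inter> ?p ` H"
    then obtain x h where x: "x \<in> W" "h \<in> H" "u = ?p x" "?p x = ?p h" by auto
    have c: "x \<in> carrier V" "h \<in> carrier V" using x W_subset by (auto simp: H_def)
    \<comment> \<open>As \<open>H\<close> contains \<open>\<Gamma>\<close>, a vector congruent to
      one of \<open>H\<close> modulo \<open>\<Gamma>\<close> lies in \<open>H\<close>.\<close>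
    have "x \<ominus>\<^bsub>V\<^esub> h \<in> H" using coset_eq_iff[OF \<Gamma> c] x(4) \<Gamma>H by auto
    then have "(x \<ominus>\<^bsub>V\<^esub> h) \<oplus>\<^bsub>V\<^esub> h \<in> H" using H x(2) by (simp add: subspace_iff)
    then show "u \<in> ?p ` (W \<inter> H)" using x minus_add_cancel[OF c] by auto
  qed auto
  moreover have "subdim E ?P (quot_image V \<Gamma> W \<inter> ?p ` H) + 1 < subdim E ?P (quot_image V \<Gamma> W)"
    using del p.image_subspace[OF H] hyp unfolding has_delsarte_dual_def by blast
  \<comment> \<open>The coset map keeps \<open>F\<close>-dimensions on \<open>W\<close>, so the
    codimension in the quotient is exactly one, against the strict inequality.\<close>
  ultimately show False using dim_image[OF WH] dim_image[OF W] WH1 unfolding U by simp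
qed

text \<open>A vector of \<open>\<Gamma>\<close> is determined by its pairings with lifts of a basis
  of the quotient: two vectors with equal pairings differ by one orthogonal to all of
  \<open>W\<close>, hence by zero.\<close>

lemma subdim_le_dim_quot_orth_compl:
  assumes \<Gamma>: "VectorSpace.subspace K \<Gamma> V"
  shows "subdim K V \<Gamma> \<le> vectorspace.dim K (quot_space V (orth_compl K V \<sigma> \<Gamma>))"
proof -
  define N where "N = orth_compl K V \<sigma> \<Gamma>"
  have \<Gamma>V: "\<Gamma> \<subseteq> carrier V" using \<Gamma> by (simp add: subspace_iff)
  have N: "VectorSpace.subspace K N V" unfolding N_def by (rule orth_compl_subspace[OF \<Gamma>V])
  let ?Q = "quot_space V N" and ?p = "\<lambda>x. N +>\<^bsub>V\<^esub> x"
  interpret Q: finite_vectorspace K ?Q by (rule quot_space_finite_vectorspace[OF N])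
  interpret p: linear_map K V ?Q ?p by (rule quot_space_proj_linear[OF N])
  obtain B where B: "finite B" "B \<subseteq> carrier ?Q" "lspan K ?Q B = carrier ?Q" "card B = Q.dim"
    using Q.subspace_basis[OF Q.subspace_carrier] Q.subdim_carrier by metis
  \<comment> \<open>A choice of coset representatives; pairings with \<open>\<Gamma>\<close> do not
    depend on it, since \<open>\<Gamma>\<close> is orthogonal to \<open>N\<close>.\<close>
  define l where "l = inv_into (carrier V) ?p"
  have l: "l b \<in> carrier V" "?p (l b) = b" if "b \<in> B" for b
  proof -
    have b: "b \<in> ?p ` carrier V" using B(2) that by (auto simp: quot_space_carrier)
    show "l b \<in> carrier V" unfolding l_def by (rule inv_into_into[OF b])
    show "?p (l b) = b" unfolding l_def by (rule f_inv_into_f[OF b])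
  qed
  have "card (id ` \<Gamma>) \<le> card (carrier K) ^ card B"
  proof (rule card_image_le_pow[where f = "\<lambda>x b. \<sigma> x (l b)"])
    show "finite B" by (rule B(1))
    show "finite (carrier K)" by (rule finite_scalars)
    show "finite \<Gamma>" by (rule finite_subspace[OF \<Gamma>])
    show "\<sigma> x (l b) \<in> carrier K" if "x \<in> \<Gamma>" "b \<in> B" for x b
      by (rule form_closed[OF subsetD[OF \<Gamma>V that(1)] l(1)[OF that(2)]])
    show "id x = id x'" if x: "x \<in> \<Gamma>" "x' \<in> \<Gamma>" and eq: "\<And>b. b \<in> B \<Longrightarrow> \<sigma> x (l b) = \<sigma> x' (l b)" for x x'
    proof -
      have c: "x \<in> carrier V" "x' \<in> carrier V" using x \<Gamma>V by auto
      define z where "z = x \<ominus>\<^bsub>V\<^esub> x'"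
      have z\<Gamma>: "z \<in> \<Gamma>" unfolding z_def by (rule subspace_minus[OF \<Gamma> x])
      have zV: "z \<in> carrier V" using z\<Gamma> \<Gamma>V by blast
      \<comment> \<open>\<open>Z\<close> contains every lift \<open>l b\<close>, so its image
        contains a spanning set and is the whole quotient.\<close>
      define Z where "Z = orth_compl K V \<sigma> {z}"
      have Z: "VectorSpace.subspace K Z V" unfolding Z_def by (rule orth_compl_subspace) (use zV in simp)
      have "b \<in> ?p ` Z" if "b \<in> B" for b
      proof -
        have "\<sigma> z (l b) = \<zero>\<^bsub>K\<^esub>"
          using form_eq_iff_left[OF c l(1)[OF that]] eq[OF that] by (simp add: z_def)
        then have "l b \<in> Z" using l(1)[OF that] by (simp add: Z_def orth_compl_def)
        then show ?thesis using l(2)[OF that] by (metis imageI)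
      qed
      then have Q_sub: "carrier ?Q \<subseteq> ?p ` Z"
        using Q.span_minimal[OF p.image_subspace[OF Z], of B] B(3) by blast
      have "\<sigma> z w = \<zero>\<^bsub>K\<^esub>" if "w \<in> W" for w
      proof -
        have wV: "w \<in> carrier V" using that W_subset by blast
        then have "?p w \<in> ?p ` Z" using Q_sub by (auto simp: quot_space_carrier)
        then obtain v where v: "v \<in> Z" "?p w = ?p v" by blast
        have vV: "v \<in> carrier V" using v(1) by (simp add: Z_def orth_compl_def)
        \<comment> \<open>Every \<open>w\<close> agrees with some \<open>v\<close> in
          \<open>Z\<close> up to an element of \<open>N\<close>, and \<open>z\<close>, being in
          \<open>\<Gamma>\<close>, is orthogonal to both.\<close>
        have "w \<ominus>\<^bsub>V\<^esub> v \<in> N" using coset_eq_iff[OF N wV vV] v(2) by simp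
        then have "\<sigma> z (w \<ominus>\<^bsub>V\<^esub> v) = \<zero>\<^bsub>K\<^esub>" using z\<Gamma> by (simp add: N_def orth_compl_def)
        then show ?thesis
          using form_eq_iff_right[OF wV vV zV] v(1) by (simp add: Z_def orth_compl_def)
      qed
      then have "z = \<zero>\<^bsub>V\<^esub>" by (rule nondegenerate_left[OF zV])
      then show ?thesis using minus_add_cancel[OF c] c by (simp add: z_def)
    qed
  qed
  then have "card (carrier K) ^ subdim K V \<Gamma> \<le> card (carrier K) ^ Q.dim"
    using card_subspace[OF \<Gamma>] B(4) by simp
  then show ?thesis using card_scalars_gt_1 by (simp add: N_def)
qed

end

section \<open>The Delsarte dual\<close>

theorem (in rational_form) decomposable_delsarte_dual:
  assumes dim_W: "subdim E V W = dim"
    and \<Gamma>: "VectorSpace.subspace K \<Gamma> V" and \<Gamma>W: "\<Gamma> \<inter> W = {\<zero>\<^bsub>V\<^esub>}"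
    and del: "has_delsarte_dual K F (quot_space V \<Gamma>) (quot_image V \<Gamma> W)"
    and less: "\<forall>i\<in>{1..t}. ks i < ns i"
    and dec: "decomposable K F (quot_space V \<Gamma>) (quot_image V \<Gamma> W) t ks ns"
  shows "decomposable K F (quot_space V (orth_compl K V \<sigma> \<Gamma>))
           (quot_image V (orth_compl K V \<sigma> \<Gamma>) W) t (\<lambda>i. ns i - ks i) ns"
proof -
  define N where "N = orth_compl K V \<sigma> \<Gamma>"
  define I where "I = {1..t}"
  let ?P = "quot_space V \<Gamma>" and ?p = "\<lambda>x. \<Gamma> +>\<^bsub>V\<^esub> x"
  let ?Q = "quot_space V N" and ?r = "\<lambda>x. N +>\<^bsub>V\<^esub> x"
  have \<Gamma>V: "\<Gamma> \<subseteq> carrier V" using \<Gamma> by (simp add: subspace_iff)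
  have N: "VectorSpace.subspace K N V" unfolding N_def by (rule orth_compl_subspace[OF \<Gamma>V])
  \<comment> \<open>The hyperplane condition on \<open>U\<close> enters here: it makes the dual
    quotient map injective on \<open>W\<close>.\<close>
  have NW: "W \<inter> N = {\<zero>\<^bsub>V\<^esub>}" unfolding N_def by (rule W_Int_orth_compl[OF \<Gamma> \<Gamma>W del])
  interpret E: finite_vectorspace E V by (rule E_finite_vectorspace)
  interpret P: finite_vectorspace K ?P by (rule quot_space_finite_vectorspace[OF \<Gamma>])
  interpret p: linear_map K V ?P ?p by (rule quot_space_proj_linear[OF \<Gamma>])
  interpret PE: finite_vectorspace E ?P by (rule P.finite_vectorspace_restrict_scalars[OF F])
  interpret pE: linear_map E V ?P ?p by (rule p.linear_map_restrict_scalars[OF F])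
  interpret Q: finite_vectorspace K ?Q by (rule quot_space_finite_vectorspace[OF N])
  interpret r: linear_map K V ?Q ?r by (rule quot_space_proj_linear[OF N])
  interpret QE: finite_vectorspace E ?Q by (rule Q.finite_vectorspace_restrict_scalars[OF F])
  interpret rE: linear_map E V ?Q ?r by (rule r.linear_map_restrict_scalars[OF F])
  have I: "finite I" by (simp add: I_def)
  have U: "quot_image V \<Gamma> W = ?p ` W" by (rule quot_image_eq[OF \<Gamma> W_subset])
  have inj: "inj_on ?p W" by (rule coset_inj_on[OF \<Gamma> F W]) (use \<Gamma>W in blast)

  \<comment> \<open>The given decomposition of \<open>U\<close>\<close>
  have dimP: "P.dim = (\<Sum>i\<in>I. ks i)" and dimU: "subdim E ?P (?p ` W) = (\<Sum>i\<in>I. ns i)"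
    using dec unfolding decomposable_def U I_def by blast+
  obtain Us where Us: "\<forall>i\<in>I. VectorSpace.subspace E (Us i) ?P \<and> subdim E ?P (Us i) = ns i \<and>
        subdim K ?P (lspan K ?P (Us i)) = ks i"
    and dsU: "internal_direct_sum ?P (?p ` W) I Us"
    and dsP: "internal_direct_sum ?P (carrier ?P) I (\<lambda>i. lspan K ?P (Us i))"
    using dec unfolding decomposable_def U I_def by blast
  have UsP: "Us i \<subseteq> carrier ?P" if "i \<in> I" for i using Us that by (simp add: PE.subspace_iff)
  have UsU: "Us i \<subseteq> ?p ` W" if i: "i \<in> I" for i
  proof
    fix u assume "u \<in> Us i"
    then have "u \<in> sumset ?P I Us"
      using Us by (intro P.sumset_component[OF I i _ UsP]) (auto simp: PE.subspace_iff)
    then show "u \<in> ?p ` W" using internal_direct_sum_sumset[OF dsU] by simp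
  qed
  have dimWn: "subdim E V W = (\<Sum>i\<in>I. ns i)"
    using subdim_coset_image_rational[OF \<Gamma> _ W order_refl] \<Gamma>W dimU by (simp add: Int_commute)

  \<comment> \<open>Pulling the components back to \<open>W\<close>\<close>
  define Ws where "Ws i = W \<inter> {x \<in> carrier V. ?p x \<in> Us i}" for i
  have WsW: "Ws i \<subseteq> W" for i by (auto simp: Ws_def)
  have WsV: "Ws i \<subseteq> carrier V" for i using WsW W_subset by blast
  have Ws: "VectorSpace.subspace E (Ws i) V" if "i \<in> I" for i
    unfolding Ws_def using Us that by (intro E.subspace_Int[OF W] pE.vimage_subspace) blast
  have pWs: "?p ` Ws i = Us i" if "i \<in> I" for i
    unfolding Ws_def using UsU[OF that] W_subset by blast
  have dimWs: "subdim E V (Ws i) = ns i" if "i \<in> I" for i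
    using subdim_coset_image_rational[OF \<Gamma> _ Ws[OF that] WsW] \<Gamma>W pWs[OF that] Us that
    by (simp add: Int_commute)
  have sumWs: "sumset V I Ws = W"
  proof -
    have "?p ` sumset V I Ws = sumset ?P I (\<lambda>i. ?p ` Ws i)" by (rule p.image_sumset) (rule WsV)
    also have "\<dots> = sumset ?P I Us" by (rule sumset_cong) (rule pWs)
    also have "\<dots> = ?p ` W" by (rule internal_direct_sum_sumset[OF dsU])
    finally have im: "?p ` sumset V I Ws = ?p ` W" .
    have sub: "sumset V I Ws \<subseteq> W"
    proof
      fix v assume "v \<in> sumset V I Ws"
      then obtain f where f: "\<And>i. i \<in> I \<Longrightarrow> f i \<in> Ws i" "v = (\<Oplus>\<^bsub>V\<^esub>i\<in>I. f i)" by (metis sumsetE)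
      show "v \<in> W" unfolding f(2) by (rule E.subspace_finsum[OF W]) (use f(1) WsW in blast)
    qed
    \<comment> \<open>Injectivity of the coset map on \<open>W\<close> lifts the equality of images
      to \<open>W\<close>.\<close>
    show ?thesis by (rule inj_on_image_eq_iff[OF inj sub order_refl, THEN iffD1, OF im])
  qed
  have dims: "(\<Sum>i\<in>I. subdim E V (Ws i)) = subdim E V W"
    unfolding dimWn using dimWs by (intro sum.cong) auto

  \<comment> \<open>The induced splitting of \<open>\<Gamma>\<close>\<close>
  define Vs where "Vs i = span (Ws i)" for i
  have Vs: "VectorSpace.subspace K (Vs i) V" for i unfolding Vs_def by (rule span_is_subspace[OF WsV])
  have sumVs: "sumset V I Vs = carrier V"
    unfolding Vs_def using sumset_span[OF WsV sumWs W_subset WsW] span_W by simp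
  have pVs: "?p ` Vs i = lspan K ?P (Us i)" if "i \<in> I" for i
    unfolding Vs_def using p.image_span[OF WsV] pWs[OF that] by simp
  \<comment> \<open>An \<open>F\<close>-basis of \<open>Ws i\<close> has \<open>ns i\<close>
    elements and spans \<open>Vs i\<close> over \<open>K\<close>.\<close>
  have dimVs: "subdim K V (Vs i) \<le> ns i" if i: "i \<in> I" for i
  proof -
    obtain B where B: "finite B" "B \<subseteq> Ws i" "lspan E V B = Ws i" "card B = ns i"
      using E.subspace_basis[OF Ws[OF i]] dimWs[OF i] by metis
    have BV: "B \<subseteq> carrier V" using B(2) WsV by blast
    have "Ws i \<subseteq> span B" using span_restrict_scalars_subset[OF F BV] B(3) by simp
    then have "Vs i \<subseteq> span B" unfolding Vs_def by (rule span_minimal[OF span_is_subspace[OF BV]])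
    moreover have "span B \<subseteq> Vs i" unfolding Vs_def by (rule span_is_monotone[OF B(2)])
    ultimately have "Vs i = span B" by blast
    then show ?thesis using subdim_span_le[OF B(1) BV] B(4) by simp
  qed
  define \<Gamma>s where "\<Gamma>s i = Vs i \<inter> \<Gamma>" for i
  have \<Gamma>s: "VectorSpace.subspace K (\<Gamma>s i) V" for i unfolding \<Gamma>s_def by (rule subspace_Int[OF Vs \<Gamma>])
  \<comment> \<open>Rank-nullity on \<open>Vs i\<close>, whose image has dimension
    \<open>ks i\<close> and whose kernel is \<open>\<Gamma>s i\<close>.\<close>
  have dim\<Gamma>s: "subdim K V (\<Gamma>s i) \<le> ns i - ks i" if i: "i \<in> I" for i
    using subdim_coset_image[OF \<Gamma> Vs, of i] dimVs[OF i] pVs[OF i] Us i by (simp add: \<Gamma>s_def)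
  have \<Gamma>_decomp: "\<exists>f. (\<forall>i\<in>I. f i \<in> \<Gamma>s i) \<and> x = (\<Oplus>\<^bsub>V\<^esub>i\<in>I. f i)" if x: "x \<in> \<Gamma>" for x
  proof -
    have xV: "x \<in> carrier V" using x \<Gamma>V by blast
    then obtain f where f: "\<And>i. i \<in> I \<Longrightarrow> f i \<in> Vs i" "x = (\<Oplus>\<^bsub>V\<^esub>i\<in>I. f i)"
      unfolding sumVs[symmetric] by (metis sumsetE)
    have fV: "f i \<in> carrier V" if "i \<in> I" for i using f(1)[OF that] Vs[of i] by (auto simp: subspace_iff)
    have p0: "?p y = \<zero>\<^bsub>?P\<^esub> \<longleftrightarrow> y \<in> \<Gamma>" if "y \<in> carrier V" for y
    proof -
      have "y \<ominus>\<^bsub>V\<^esub> \<zero>\<^bsub>V\<^esub> = y" using minus_add_cancel[OF that M.zero_closed] that by simp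
      then show ?thesis using coset_eq_iff[OF \<Gamma> that M.zero_closed] p.T0_is_0 by simp
    qed
    have "(\<Oplus>\<^bsub>?P\<^esub>i\<in>I. ?p (f i)) = ?p x" unfolding f(2) by (rule p.image_finsum[symmetric]) (rule fV)
    also have "\<dots> = \<zero>\<^bsub>?P\<^esub>" using p0[OF xV] x by simp
    finally have s0: "(\<Oplus>\<^bsub>?P\<^esub>i\<in>I. ?p (f i)) = \<zero>\<^bsub>?P\<^esub>" .
    \<comment> \<open>The images of the summands add up to zero in a direct sum, so each of them is
      zero.\<close>
    have "f i \<in> \<Gamma>" if i: "i \<in> I" for i
    proof -
      have "?p (f i) = \<zero>\<^bsub>?P\<^esub>"
      proof (rule P.internal_direct_sum_zero[OF dsP _ _ s0 i])
        show "VectorSpace.subspace K (lspan K ?P (Us j)) ?P" if "j \<in> I" for j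
          by (rule P.span_is_subspace[OF UsP[OF that]])
        show "?p (f j) \<in> lspan K ?P (Us j)" if "j \<in> I" for j
          using f(1)[OF that] pVs[OF that] by blast
      qed
      then show ?thesis using p0[OF fV[OF i]] by simp
    qed
    then show ?thesis using f by (intro exI[of _ f]) (simp add: \<Gamma>s_def)
  qed

  \<comment> \<open>The dual components and their spans\<close>
  define D where "D = dual_component I Ws"
  have DW: "D i \<subseteq> W" for i by (auto simp: D_def dual_component_def)
  have DV: "D i \<subseteq> carrier V" for i using DW W_subset by blast
  have D: "VectorSpace.subspace E (D i) V" for i unfolding D_def by (rule dual_component_subspace) (rule WsV)
  have sumD: "sumset V I D = W"
    unfolding D_def by (rule sumset_dual_component[OF I Ws sumWs dims])
  have dimD: "subdim E V (D i) = ns i" if i: "i \<in> I" for i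
    using subdim_dual_component[OF I Ws sumWs dims i] dimWs[OF i] by (simp add: D_def)
  define Ds where "Ds i = span (D i)" for i
  have Ds: "VectorSpace.subspace K (Ds i) V" for i unfolding Ds_def by (rule span_is_subspace[OF DV])
  have DsV: "Ds i \<subseteq> carrier V" for i using Ds by (simp add: subspace_iff)
  have sumDs: "sumset V I Ds = carrier V"
    unfolding Ds_def using sumset_span[OF DV sumD W_subset DW] span_W by simp
  \<comment> \<open>Orthogonality of \<open>Ws j\<close> and \<open>D i\<close> extends to the
    \<open>K\<close>-spans, one argument at a time.\<close>
  have orth: "\<sigma> x y = \<zero>\<^bsub>K\<^esub>" if ij: "j \<in> I" "j \<noteq> i" and x: "x \<in> Vs j" and y: "y \<in> Ds i" for i j x y
  proof (rule form_zero_on_span_left[OF WsV])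
    show yV: "y \<in> carrier V" using y DsV by blast
    show "x \<in> span (Ws j)" using x by (simp add: Vs_def)
    show "\<sigma> w y = \<zero>\<^bsub>K\<^esub>" if w: "w \<in> Ws j" for w
    proof (rule form_zero_on_span_right[OF DV])
      show "w \<in> carrier V" using w WsV by blast
      show "y \<in> span (D i)" using y by (simp add: Ds_def)
      show "\<sigma> w d = \<zero>\<^bsub>K\<^esub>" if "d \<in> D i" for d
        using that ij w by (simp add: D_def dual_component_def)
    qed
  qed
  have dim_rDs_le: "subdim K ?Q (?r ` Ds i) \<le> ns i - ks i" if i: "i \<in> I" for i
  proof -
    obtain B where B: "finite B" "B \<subseteq> \<Gamma>s i" "span B = \<Gamma>s i" "card B = subdim K V (\<Gamma>s i)"
      using subspace_basis[OF \<Gamma>s] by metis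
    have BV: "B \<subseteq> carrier V" using B(2) \<Gamma>s[of i] by (auto simp: subspace_iff)
    have "card (?r ` Ds i) \<le> card (carrier K) ^ card B"
    proof (rule card_image_le_pow[where f = "\<lambda>y b. \<sigma> b y"])
      show "finite B" by (rule B(1))
      show "finite (carrier K)" by (rule finite_scalars)
      show "finite (Ds i)" by (rule finite_subspace[OF Ds])
      show "\<sigma> b y \<in> carrier K" if "y \<in> Ds i" "b \<in> B" for y b
        by (rule form_closed[OF subsetD[OF BV that(2)] subsetD[OF DsV that(1)]])
      show "?r y = ?r y'" if y: "y \<in> Ds i" "y' \<in> Ds i" and eq: "\<And>b. b \<in> B \<Longrightarrow> \<sigma> b y = \<sigma> b y'" for y y'
      proof -
        have c: "y \<in> carrier V" "y' \<in> carrier V" using y DsV by auto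
        define z where "z = y \<ominus>\<^bsub>V\<^esub> y'"
        have zD: "z \<in> Ds i" unfolding z_def by (rule subspace_minus[OF Ds y])
        have zV: "z \<in> carrier V" using zD DsV by blast
        have Bz: "\<sigma> b z = \<zero>\<^bsub>K\<^esub>" if "b \<in> B" for b
          using form_eq_iff_right[OF c subsetD[OF BV that]] eq[OF that] by (simp add: z_def)
        have "\<sigma> x z = \<zero>\<^bsub>K\<^esub>" if x: "x \<in> \<Gamma>" for x
        proof -
          obtain f where f: "\<forall>i\<in>I. f i \<in> \<Gamma>s i" "x = (\<Oplus>\<^bsub>V\<^esub>i\<in>I. f i)" using \<Gamma>_decomp[OF x] by blast
          \<comment> \<open>The summand at \<open>i\<close> lies in the span of \<open>B\<close>, on
            which \<open>z\<close> pairs to zero; the others are covered by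
            \<open>orth\<close>.\<close>
          have "f j \<in> {x \<in> carrier V. \<sigma> x z = \<zero>\<^bsub>K\<^esub>}" if j: "j \<in> I" for j
          proof (cases "j = i")
            case True
            then have fB: "f j \<in> span B" using f(1) j B(3) by simp
            have "\<sigma> (f j) z = \<zero>\<^bsub>K\<^esub>" by (rule form_zero_on_span_left[OF BV zV _ fB]) (rule Bz)
            then show ?thesis using f(1) j \<Gamma>V by (auto simp: \<Gamma>s_def)
          next
            case False
            then have "\<sigma> (f j) z = \<zero>\<^bsub>K\<^esub>" using orth[OF j False _ zD] f(1) j by (simp add: \<Gamma>s_def)
            then show ?thesis using f(1) j \<Gamma>V by (auto simp: \<Gamma>s_def)
          qed
          then have "x \<in> {x \<in> carrier V. \<sigma> x z = \<zero>\<^bsub>K\<^esub>}"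
            unfolding f(2) by (rule subspace_finsum[OF left_kernel_subspace[OF zV]])
          then show ?thesis by simp
        qed
        then have "z \<in> N" using zV by (simp add: N_def orth_compl_def)
        then show ?thesis using coset_eq_iff[OF N c] by (simp add: z_def)
      qed
    qed
    then have "card (carrier K) ^ subdim K ?Q (?r ` Ds i) \<le> card (carrier K) ^ card B"
      using Q.card_subspace[OF r.image_subspace[OF Ds]] by simp
    then have "subdim K ?Q (?r ` Ds i) \<le> card B" using card_scalars_gt_1 by simp
    then show ?thesis using dim\<Gamma>s[OF i] B(4) by simp
  qed

  \<comment> \<open>Comparing dimensions in the dual quotient\<close>
  have sum_rDs: "sumset ?Q I (\<lambda>i. ?r ` Ds i) = carrier ?Q"
    using r.image_sumset[of I Ds, OF DsV] sumDs by (simp add: quot_space_carrier)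
  have rDs: "VectorSpace.subspace K (?r ` Ds i) ?Q" for i by (rule r.image_subspace[OF Ds])
  have "dim = subdim K V \<Gamma> + P.dim"
    using subdim_coset_image[OF \<Gamma> subspace_carrier] \<Gamma>V P.subdim_carrier
    by (simp add: Int_absorb1 quot_space_carrier)
  then have "(\<Sum>i\<in>I. ns i) = subdim K V \<Gamma> + (\<Sum>i\<in>I. ks i)" using dimP dimWn dim_W by simp
  \<comment> \<open>Subtraction on \<open>nat\<close> is exact here because
    \<open>ks i < ns i\<close>.\<close>
  moreover have "(\<Sum>i\<in>I. ns i) = (\<Sum>i\<in>I. ns i - ks i) + (\<Sum>i\<in>I. ks i)"
    unfolding sum.distrib[symmetric] using less by (intro sum.cong) (simp_all add: I_def less_imp_le)
  ultimately have "(\<Sum>i\<in>I. ns i - ks i) = subdim K V \<Gamma>" by simp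
  also have "\<dots> \<le> Q.dim" using subdim_le_dim_quot_orth_compl[OF \<Gamma>] by (simp add: N_def)
  finally have Q_ge: "(\<Sum>i\<in>I. ns i - ks i) \<le> Q.dim" .
  have Q_le: "Q.dim \<le> (\<Sum>i\<in>I. subdim K ?Q (?r ` Ds i))"
    using Q.subdim_sumset_le[of I "\<lambda>i. ?r ` Ds i", OF I rDs] Q.subdim_carrier by (simp add: sum_rDs)
  have mono: "(\<Sum>i\<in>I. subdim K ?Q (?r ` Ds i)) \<le> (\<Sum>i\<in>I. ns i - ks i)"
    by (rule sum_mono) (rule dim_rDs_le)
  \<comment> \<open>\<open>Q_ge\<close>, \<open>Q_le\<close> and \<open>mono\<close> close into a
    cycle; equal sums of termwise comparable terms agree termwise.\<close>
  have dim_rDs: "subdim K ?Q (?r ` Ds i) = ns i - ks i" if "i \<in> I" for i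
  proof (rule sum_mono_inv[OF _ _ that I])
    show "(\<Sum>i\<in>I. subdim K ?Q (?r ` Ds i)) = (\<Sum>i\<in>I. ns i - ks i)" using Q_ge Q_le mono by simp
  qed (rule dim_rDs_le)
  have dimQ: "Q.dim = (\<Sum>i\<in>I. ns i - ks i)" using Q_ge Q_le mono by simp

  \<comment> \<open>Assembling the decomposition of the dual\<close>
  have span_rD: "lspan K ?Q (?r ` D i) = ?r ` Ds i" for i
    unfolding Ds_def using r.image_span[OF DV] by simp
  have rD: "VectorSpace.subspace E (?r ` D i) ?Q" for i by (rule rE.image_subspace[OF D])
  have dim_rD: "subdim E ?Q (?r ` D i) = ns i" if "i \<in> I" for i
    using subdim_coset_image_rational[OF N _ D DW] NW dimD[OF that] by simp
  have rW: "VectorSpace.subspace E (?r ` W) ?Q" by (rule rE.image_subspace[OF W])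
  have dim_rW: "subdim E ?Q (?r ` W) = (\<Sum>i\<in>I. ns i)"
    using subdim_coset_image_rational[OF N _ W order_refl] NW dimWn by simp
  have "internal_direct_sum ?Q (?r ` W) I (\<lambda>i. ?r ` D i)"
  proof (rule QE.internal_direct_sumI_subdim[OF I rD])
    show "sumset ?Q I (\<lambda>i. ?r ` D i) = ?r ` W" using r.image_sumset[of I D, OF DV] sumD by simp
    show "subdim E ?Q (?r ` W) = (\<Sum>i\<in>I. subdim E ?Q (?r ` D i))"
      unfolding dim_rW using dim_rD by (intro sum.cong) auto
  qed
  moreover have "internal_direct_sum ?Q (carrier ?Q) I (\<lambda>i. ?r ` Ds i)"
  proof (rule Q.internal_direct_sumI_subdim[OF I rDs sum_rDs])
    show "subdim K ?Q (carrier ?Q) = (\<Sum>i\<in>I. subdim K ?Q (?r ` Ds i))"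
      unfolding Q.subdim_carrier dimQ using dim_rDs by (intro sum.cong) auto
  qed
  moreover have "\<forall>i\<in>I. VectorSpace.subspace E (?r ` D i) ?Q \<and> subdim E ?Q (?r ` D i) = ns i \<and>
      subdim K ?Q (lspan K ?Q (?r ` D i)) = ns i - ks i"
    using rD dim_rD dim_rDs span_rD by simp
  moreover have "vectorspace.fin_dim E (?Q\<lparr>carrier := ?r ` W\<rparr>)"
    by (rule finite_vectorspace.fin_dim[OF QE.subspace_finite_vectorspace[OF rW]])
  moreover have "quot_image V N W = ?r ` W" by (rule quot_image_eq[OF N W_subset])
  ultimately have "decomposable K F ?Q (quot_image V N W) t (\<lambda>i. ns i - ks i) ns"
    unfolding decomposable_def I_def[symmetric] span_rD[symmetric]
    using Q.vectorspace_axioms Q.fin_dim dimQ rW dim_rW by auto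
  then show ?thesis by (simp add: N_def)
qed

theorem theorem1p35:
  fixes K :: "('a, 'b) ring_scheme" and F :: "'a set" and V :: "('a, 'v, 'c) module_scheme"
    and W \<Gamma> :: "'v set" and \<sigma>' \<sigma> :: "'v \<Rightarrow> 'v \<Rightarrow> 'a"
    and q m k n t :: nat and ks ns :: "nat \<Rightarrow> nat"
  assumes "primepow q" and "m > 0" and "1 \<le> k" and "k < n"
    and "field K" and "card (carrier K) = q ^ m"
    and "subfield F K" and "card F = q"
    and "vectorspace K V" and "vectorspace.fin_dim K V" and "vectorspace.dim K V = n"
    and "VectorSpace.subspace (K\<lparr>carrier := F\<rparr>) W V"
    and "subdim (K\<lparr>carrier := F\<rparr>) V W = n"
    and "lspan K V W = carrier V"
    and "bilinear_form (K\<lparr>carrier := F\<rparr>) (V\<lparr>carrier := W\<rparr>) \<sigma>'"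
    and "nondegenerate_form (K\<lparr>carrier := F\<rparr>) (V\<lparr>carrier := W\<rparr>) \<sigma>'"
    and "reflexive_form (K\<lparr>carrier := F\<rparr>) (V\<lparr>carrier := W\<rparr>) \<sigma>'"
    and "bilinear_form K V \<sigma>" and "\<forall>x\<in>W. \<forall>y\<in>W. \<sigma> x y = \<sigma>' x y"
    and "VectorSpace.subspace K \<Gamma> V" and "subdim K V \<Gamma> = n - k"
    and "\<Gamma> \<inter> W = {\<zero>\<^bsub>V\<^esub>}"
    and "has_delsarte_dual K F (quot_space V \<Gamma>) (quot_image V \<Gamma> W)"
    and "k = (\<Sum>i=1..t. ks i)" and "n = (\<Sum>i=1..t. ns i)"
    and "\<forall>i\<in>{1..t}. ks i < ns i"
    and "decomposable K F (quot_space V \<Gamma>) (quot_image V \<Gamma> W) t ks ns"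
  shows "decomposable K F (quot_space V (orth_compl K V \<sigma> \<Gamma>))
           (quot_image V (orth_compl K V \<sigma> \<Gamma>) W) t (\<lambda>i. ns i - ks i) ns"
proof -
  interpret V: vectorspace K V by fact
  \<comment> \<open>An infinite set has \<open>card\<close> zero, so a nonzero cardinality yields
    finiteness.\<close>
  have "card (carrier K) \<noteq> 0"
    using primepow_gt_Suc_0[OF assms(1)] assms(6) by simp
  then have finK: "finite (carrier K)" by (rule card_ge_0_finite[OF neq0_conv[THEN iffD1]])
  have finV: "finite (carrier V)" by (rule V.fin_dim_imp_finite_carrier[OF assms(10) finK])
  interpret rational_form K V F W \<sigma>
  proof (intro rational_form.intro finite_vectorspace.intro finite_vectorspace_axioms.intro
      rational_form_axioms.intro)
    \<comment> \<open>On \<open>W\<close> the form is \<open>\<sigma>'\<close>, whose scalars form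
      the carrier \<open>F\<close>.\<close>
    show "\<sigma> x y \<in> F" if "x \<in> W" "y \<in> W" for x y
      using assms(15,19) that by (simp add: bilinear_form_def)
    show "y = \<zero>\<^bsub>V\<^esub>" if "y \<in> W" "\<And>x. x \<in> W \<Longrightarrow> \<sigma> x y = \<zero>\<^bsub>K\<^esub>" for y
      using assms(16,19) that by (simp add: nondegenerate_form_def)
  qed (fact V.vectorspace_axioms finK finV assms)+
  show ?thesis
    using assms(11,13) by (intro decomposable_delsarte_dual assms) simp
qed

end
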